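(* Let $(H,\mu_H,\Delta_H,\alpha_H)$ be a Hom-bialgebra with $\alpha_H$ bijective. For Yetter-Drinfeld modules $(M,\alpha_M)$, $(N,\alpha_N)$ over $H$ define the linear map $$B_{M,N}:M\otimes N\to N\otimes M,\qquad B_{M,N}(m\otimes n)=\alpha_H^{-1}(m_{(-1)})\cdot n\otimes m_{(0)}.$$ Then $(\alpha_N\otimes\alpha_M)\circ B_{M,N}=B_{M,N}\circ(\alpha_M\otimes\alpha_N)$ and, if $(P,\alpha_P)$ is another Yetter-Drinfeld module over $H$, the maps $B_{-,-}$ satisfy the Hom-Yang-Baxter equation $$(\alpha_P\otimes B_{M,N})\circ(B_{M,P}\otimes\alpha_N)\circ(\alpha_M\otimes B_{N,P})=(B_{N,P}\otimes\alpha_M)\circ(\alpha_N\otimes B_{M,P})\circ(B_{M,N}\otimes\alpha_P).$$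
   Context: Everything is over a field $k$, $\otimes=\otimes_k$; (co)algebras are not assumed (co)unital. Sweedler notation: $\Delta(h)=h_1\otimes h_2$; multiplications are written by juxtaposition. A Hom-bialgebra is $(H,\mu,\Delta,\alpha)$ with $\mu:H\otimes H\to H$, $\Delta:H\to H\otimes H$, $\alpha:H\to H$ linear such that for all $h,h',h''$: $\alpha(hh')=\alpha(h)\alpha(h')$; $\alpha(h)(h'h'')=(hh')\alpha(h'')$; $\Delta(h_1)\otimes\alpha(h_2)=\alpha(h_1)\otimes\Delta(h_2)$; $\Delta(hh')=h_1h'_1\otimes h_2h'_2$; $\Delta(\alpha(h))=\alpha(h_1)\otimes\alpha(h_2)$. Let $(H,\mu_H,\Delta_H,\alpha_H)$ be a Hom-bialgebra, $M$ a linear space, $\alpha_M:M\to M$ linear. $(M,\alpha_M)$ is a left $H$-module if there is a linear map $H\otimes M\to M$, $h\otimes m\mapsto h\cdot m$, with $\alpha_M(h\cdot m)=\alpha_H(h)\cdot\alpha_M(m)$ and $\alpha_H(h)\cdot(h'\cdot m)=(hh')\cdot\alpha_M(m)$. It is a left $H$-comodule if there is a linear map $\lambda:M\to H\otimes M$, $\lambda(m)=m_{(-1)}\otimes m_{(0)}$, with $(\alpha_H\otimes\alpha_M)\circ\lambda=\lambda\circ\alpha_M$ and $(\Delta_H\otimes\alpha_M)\circ\lambda=(\alpha_H\otimes\lambda)\circ\lambda$. $(M,\alpha_M)$ is a (left-left) Yetter-Drinfeld module over $H$ if it is both a left $H$-module and a left $H$-comodule and, for all $h\in H$, $m\in M$,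 $$(h_1\cdot m)_{(-1)}\alpha_H^2(h_2)\otimes(h_1\cdot m)_{(0)}=\alpha_H^2(h_1)\alpha_H(m_{(-1)})\otimes\alpha_H(h_2)\cdot m_{(0)}.$$ *)

theory Defs
  imports "Jordan_Normal_Form.Missing_VectorSpace" "HOL-Algebra.AbelCoset"
begin

section \<open>Tensor products of vector spaces\<close>

text \<open>
  The tensor product of \<open>M\<close> and \<open>N\<close> over the field \<open>K\<close> is the free vector space on the set
  \<open>carrier M \<times> carrier N\<close> modulo the subspace spanned by the bilinearity relations, so its
  elements are cosets of that subspace.
\<close>

definition free_space :: "('k, 'r) ring_scheme \<Rightarrow> 'i set \<Rightarrow> ('k, 'i \<Rightarrow> 'k) module" where
  "free_space K S = (ring.func_space K S)
     \<lparr>carrier := {x \<in> S \<rightarrow>\<^sub>E carrier K. finite {i \<in> S. x i \<noteq> \<zero>\<^bsub>K\<^esub>}}\<rparr>"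

definition free_gen :: "('k, 'r) ring_scheme \<Rightarrow> 'i set \<Rightarrow> 'i \<Rightarrow> 'i \<Rightarrow> 'k" where
  "free_gen K S i = (\<lambda>j\<in>S. if j = i then \<one>\<^bsub>K\<^esub> else \<zero>\<^bsub>K\<^esub>)"

definition pair_space ::
  "('k, 'r) ring_scheme \<Rightarrow> ('k, 'm, 'a) module_scheme \<Rightarrow> ('k, 'n, 'b) module_scheme
   \<Rightarrow> ('k, 'm \<times> 'n \<Rightarrow> 'k) module" where
  "pair_space K M N = free_space K (carrier M \<times> carrier N)"

definition pair_gen ::
  "('k, 'r) ring_scheme \<Rightarrow> ('k, 'm, 'a) module_scheme \<Rightarrow> ('k, 'n, 'b) module_scheme
   \<Rightarrow> 'm \<Rightarrow> 'n \<Rightarrow> 'm \<times> 'n \<Rightarrow> 'k" where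
  "pair_gen K M N m n = free_gen K (carrier M \<times> carrier N) (m, n)"

definition bilinear_relations ::
  "('k, 'r) ring_scheme \<Rightarrow> ('k, 'm, 'a) module_scheme \<Rightarrow> ('k, 'n, 'b) module_scheme
   \<Rightarrow> ('m \<times> 'n \<Rightarrow> 'k) set" where
  "bilinear_relations K M N = (let F = pair_space K M N; d = pair_gen K M N in
     {d (m \<oplus>\<^bsub>M\<^esub> m') n \<ominus>\<^bsub>F\<^esub> (d m n \<oplus>\<^bsub>F\<^esub> d m' n) | m m' n.
        m \<in> carrier M \<and> m' \<in> carrier M \<and> n \<in> carrier N} \<union>
     {d m (n \<oplus>\<^bsub>N\<^esub> n') \<ominus>\<^bsub>F\<^esub> (d m n \<oplus>\<^bsub>F\<^esub> d m n') | m n n'.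
        m \<in> carrier M \<and> n \<in> carrier N \<and> n' \<in> carrier N} \<union>
     {d (r \<odot>\<^bsub>M\<^esub> m) n \<ominus>\<^bsub>F\<^esub> r \<odot>\<^bsub>F\<^esub> d m n | r m n.
        r \<in> carrier K \<and> m \<in> carrier M \<and> n \<in> carrier N} \<union>
     {d m (r \<odot>\<^bsub>N\<^esub> n) \<ominus>\<^bsub>F\<^esub> r \<odot>\<^bsub>F\<^esub> d m n | r m n.
        r \<in> carrier K \<and> m \<in> carrier M \<and> n \<in> carrier N})"

definition tensor_kernel ::
  "('k, 'r) ring_scheme \<Rightarrow> ('k, 'm, 'a) module_scheme \<Rightarrow> ('k, 'n, 'b) module_scheme
   \<Rightarrow> ('m \<times> 'n \<Rightarrow> 'k) set" where
  "tensor_kernel K M N = module.span K (pair_space K M N) (bilinear_relations K M N)"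

text \<open>
  The union in \<open>smult\<close> is over one and the same coset; it is needed because the elementwise
  multiple of a coset by \<open>\<zero>\<^bsub>K\<^esub>\<close> is not a coset. The fields \<open>mult\<close> and \<open>one\<close>, which the
  \<open>module\<close> record inherits from rings, play no role for modules.
\<close>

definition tensor ::
  "('k, 'r) ring_scheme \<Rightarrow> ('k, 'm, 'a) module_scheme \<Rightarrow> ('k, 'n, 'b) module_scheme
   \<Rightarrow> ('k, ('m \<times> 'n \<Rightarrow> 'k) set) module" where
  "tensor K M N = (let F = pair_space K M N; R = tensor_kernel K M N in
     \<lparr>carrier = a_rcosets\<^bsub>F\<^esub> R,
      mult = undefined,
      one = undefined,
      zero = R,
      add = (\<lambda>X Y. X <+>\<^bsub>F\<^esub> Y),
      smult = (\<lambda>r X. \<Union>x\<in>X. R +>\<^bsub>F\<^esub> (r \<odot>\<^bsub>F\<^esub> x))\<rparr>)"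

definition pure_tensor ::
  "('k, 'r) ring_scheme \<Rightarrow> ('k, 'm, 'a) module_scheme \<Rightarrow> ('k, 'n, 'b) module_scheme
   \<Rightarrow> 'm \<Rightarrow> 'n \<Rightarrow> ('m \<times> 'n \<Rightarrow> 'k) set" where
  "pure_tensor K M N m n = tensor_kernel K M N +>\<^bsub>pair_space K M N\<^esub> pair_gen K M N m n"

text \<open>
  For a bilinear \<open>b\<close> with values in \<open>T\<close>, \<open>tensor_lift K M N T b\<close> is the linear map
  \<open>M \<otimes> N \<rightarrow> T\<close> with \<open>m \<otimes> n \<mapsto> b (m, n)\<close>: the formal sum \<open>\<Sum> x(m,n) (m,n)\<close> is sent to
  \<open>\<Sum> x(m,n) b (m,n)\<close>, which takes the same value on all representatives \<open>x\<close> of a coset \<open>X\<close>.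
  It renders Sweedler notation: an expression \<open>e(h\<^sub>1, h\<^sub>2)\<close> that is bilinear in the Sweedler
  components of \<open>t \<in> M \<otimes> N\<close> is \<open>tensor_lift K M N T (\<lambda>(h1, h2). e h1 h2) t\<close>.
\<close>

definition tensor_lift ::
  "('k, 'r) ring_scheme \<Rightarrow> ('k, 'm, 'a) module_scheme \<Rightarrow> ('k, 'n, 'b) module_scheme
   \<Rightarrow> ('k, 't, 'c) module_scheme \<Rightarrow> ('m \<times> 'n \<Rightarrow> 't) \<Rightarrow> ('m \<times> 'n \<Rightarrow> 'k) set \<Rightarrow> 't" where
  "tensor_lift K M N T b X = the_elem
     ((\<lambda>x. \<Oplus>\<^bsub>T\<^esub>p\<in>{p \<in> carrier M \<times> carrier N. x p \<noteq> \<zero>\<^bsub>K\<^esub>}. x p \<odot>\<^bsub>T\<^esub> b p) ` X)"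

definition tensor_map ::
  "('k, 'r) ring_scheme \<Rightarrow> ('k, 'm, 'a) module_scheme \<Rightarrow> ('k, 'n, 'b) module_scheme
   \<Rightarrow> ('k, 'm1, 'c) module_scheme \<Rightarrow> ('k, 'n1, 'd) module_scheme
   \<Rightarrow> ('m \<Rightarrow> 'm1) \<Rightarrow> ('n \<Rightarrow> 'n1) \<Rightarrow> ('m \<times> 'n \<Rightarrow> 'k) set \<Rightarrow> ('m1 \<times> 'n1 \<Rightarrow> 'k) set" where
  "tensor_map K M N M1 N1 f g =
     tensor_lift K M N (tensor K M1 N1) (\<lambda>(m, n). pure_tensor K M1 N1 (f m) (g n))"

text \<open>
  Since \<open>(A \<otimes> B) \<otimes> C\<close> and \<open>A \<otimes> (B \<otimes> C)\<close> are different types here, the identifications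
  \<open>(a \<otimes> b) \<otimes> c \<mapsto> a \<otimes> (b \<otimes> c)\<close> and \<open>a \<otimes> (b \<otimes> c) \<mapsto> (a \<otimes> b) \<otimes> c\<close> are made explicit.
\<close>

definition tensor_assoc ::
  "('k, 'r) ring_scheme \<Rightarrow> ('k, 'a, 'u) module_scheme \<Rightarrow> ('k, 'b, 'v) module_scheme
   \<Rightarrow> ('k, 'c, 'w) module_scheme
   \<Rightarrow> (('a \<times> 'b \<Rightarrow> 'k) set \<times> 'c \<Rightarrow> 'k) set \<Rightarrow> ('a \<times> ('b \<times> 'c \<Rightarrow> 'k) set \<Rightarrow> 'k) set" where
  "tensor_assoc K A B C =
     (let T = tensor K A (tensor K B C) in
      tensor_lift K (tensor K A B) C T (\<lambda>(t, c).
        tensor_lift K A B T (\<lambda>(a, b).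
          pure_tensor K A (tensor K B C) a (pure_tensor K B C b c)) t))"

definition tensor_unassoc ::
  "('k, 'r) ring_scheme \<Rightarrow> ('k, 'a, 'u) module_scheme \<Rightarrow> ('k, 'b, 'v) module_scheme
   \<Rightarrow> ('k, 'c, 'w) module_scheme
   \<Rightarrow> ('a \<times> ('b \<times> 'c \<Rightarrow> 'k) set \<Rightarrow> 'k) set \<Rightarrow> (('a \<times> 'b \<Rightarrow> 'k) set \<times> 'c \<Rightarrow> 'k) set" where
  "tensor_unassoc K A B C =
     (let T = tensor K (tensor K A B) C in
      tensor_lift K A (tensor K B C) T (\<lambda>(a, t).
        tensor_lift K B C T (\<lambda>(b, c).
          pure_tensor K (tensor K A B) C (pure_tensor K A B a b) c) t))"


subsection \<open>The universal property\<close>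

text \<open>
  \<open>tensor K M N\<close> is a \<open>K\<close>-module, and for bilinear \<open>b\<close> the map \<open>tensor_lift K M N T b\<close> is
  well defined, linear, and has the prescribed values on pure tensors.
\<close>

definition formal_sum where
  "formal_sum K T S b x = (\<Oplus>\<^bsub>T\<^esub>p\<in>{p \<in> S. x p \<noteq> \<zero>\<^bsub>K\<^esub>}. x p \<odot>\<^bsub>T\<^esub> b p)"

lemma free_space_module:
  assumes "cring K" shows "module K (free_space K S)"
proof -
  interpret cring K by fact
  interpret F: module K "func_space S" by (rule func_space_is_module)
  have sub: "submodule K {x \<in> S \<rightarrow>\<^sub>E carrier K. finite {i \<in> S. x i \<noteq> \<zero>\<^bsub>K\<^esub>}} (func_space S)"
  proof (rule submodule.intro)
    fix v w assume v: "v \<in> {x \<in> S \<rightarrow>\<^sub>E carrier K. finite {i \<in> S. x i \<noteq> \<zero>\<^bsub>K\<^esub>}}"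
      and w: "w \<in> {x \<in> S \<rightarrow>\<^sub>E carrier K. finite {i \<in> S. x i \<noteq> \<zero>\<^bsub>K\<^esub>}}"
    have "finite {i \<in> S. (v \<oplus>\<^bsub>func_space S\<^esub> w) i \<noteq> \<zero>\<^bsub>K\<^esub>}"
      by (rule finite_subset[of _ "{i \<in> S. v i \<noteq> \<zero>\<^bsub>K\<^esub>} \<union> {i \<in> S. w i \<noteq> \<zero>\<^bsub>K\<^esub>}"])
         (use v w in \<open>auto simp: func_space_def\<close>)
    moreover have "v \<oplus>\<^bsub>func_space S\<^esub> w \<in> S \<rightarrow>\<^sub>E carrier K"
      using v w by (auto simp: func_space_def PiE_mem2)
    ultimately show "v \<oplus>\<^bsub>func_space S\<^esub> w \<in> {x \<in> S \<rightarrow>\<^sub>E carrier K. finite {i \<in> S. x i \<noteq> \<zero>\<^bsub>K\<^esub>}}"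
      by blast
  next
    fix c v assume c: "c \<in> carrier K" and v: "v \<in> {x \<in> S \<rightarrow>\<^sub>E carrier K. finite {i \<in> S. x i \<noteq> \<zero>\<^bsub>K\<^esub>}}"
    have "finite {i \<in> S. (c \<odot>\<^bsub>func_space S\<^esub> v) i \<noteq> \<zero>\<^bsub>K\<^esub>}"
      by (rule finite_subset[of _ "{i \<in> S. v i \<noteq> \<zero>\<^bsub>K\<^esub>}"])
         (use c v in \<open>auto simp: func_space_def\<close>)
    moreover have "c \<odot>\<^bsub>func_space S\<^esub> v \<in> S \<rightarrow>\<^sub>E carrier K"
      using c v by (auto simp: func_space_def PiE_mem2)
    ultimately show "c \<odot>\<^bsub>func_space S\<^esub> v \<in> {x \<in> S \<rightarrow>\<^sub>E carrier K. finite {i \<in> S. x i \<noteq> \<zero>\<^bsub>K\<^esub>}}"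
      by blast
  qed (use F.module_axioms in \<open>auto simp: func_space_def\<close>)
  show ?thesis using F.submodule_is_module[OF sub] by (simp add: free_space_def)
qed

lemma free_space_simps:
  assumes "cring K"
  shows "carrier (free_space K S) = {x \<in> S \<rightarrow>\<^sub>E carrier K. finite {i \<in> S. x i \<noteq> \<zero>\<^bsub>K\<^esub>}}"
    "x \<oplus>\<^bsub>free_space K S\<^esub> y = (\<lambda>i\<in>S. x i \<oplus>\<^bsub>K\<^esub> y i)"
    "r \<odot>\<^bsub>free_space K S\<^esub> x = (\<lambda>i\<in>S. r \<otimes>\<^bsub>K\<^esub> x i)"
    "\<zero>\<^bsub>free_space K S\<^esub> = (\<lambda>i\<in>S. \<zero>\<^bsub>K\<^esub>)"
proof -
  interpret cring K by fact
  show "carrier (free_space K S) = {x \<in> S \<rightarrow>\<^sub>E carrier K. finite {i \<in> S. x i \<noteq> \<zero>\<^bsub>K\<^esub>}}"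
    "x \<oplus>\<^bsub>free_space K S\<^esub> y = (\<lambda>i\<in>S. x i \<oplus>\<^bsub>K\<^esub> y i)"
    "r \<odot>\<^bsub>free_space K S\<^esub> x = (\<lambda>i\<in>S. r \<otimes>\<^bsub>K\<^esub> x i)"
    "\<zero>\<^bsub>free_space K S\<^esub> = (\<lambda>i\<in>S. \<zero>\<^bsub>K\<^esub>)"
    by (simp_all add: free_space_def func_space_def)
qed

lemma free_gen_carrier:
  assumes "cring K" "i \<in> S" shows "free_gen K S i \<in> carrier (free_space K S)"
proof -
  interpret cring K by fact
  have "finite {j \<in> S. free_gen K S i j \<noteq> \<zero>\<^bsub>K\<^esub>}"
    by (rule finite_subset[of _ "{i}"]) (auto simp: free_gen_def)
  thus ?thesis by (auto simp: free_space_simps[OF assms(1)] free_gen_def)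
qed

lemma formal_sum_over:
  assumes "module K T" "b \<in> S \<rightarrow> carrier T" "x \<in> carrier (free_space K S)"
    "finite A" "A \<subseteq> S" "{i \<in> S. x i \<noteq> \<zero>\<^bsub>K\<^esub>} \<subseteq> A"
  shows "formal_sum K T S b x = (\<Oplus>\<^bsub>T\<^esub>p\<in>A. x p \<odot>\<^bsub>T\<^esub> b p)"
proof -
  interpret T: module K T by fact
  have x: "x i \<in> carrier K" if "i \<in> S" for i using assms(3) that by (auto simp: free_space_simps[OF T.is_cring])
  have bb: "b i \<in> carrier T" if "i \<in> A" for i using assms(2,5) that by auto
  have xA: "x i \<in> carrier K" if "i \<in> A" for i using assms(5) x that by auto
  show ?thesis unfolding formal_sum_def
  proof (rule T.M.add.finprod_mono_neutral_cong_left)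
    show "{p \<in> S. x p \<noteq> \<zero>\<^bsub>K\<^esub>} \<subseteq> A" by fact
    show "finite A" by fact
    fix i assume i: "i \<in> A - {p \<in> S. x p \<noteq> \<zero>\<^bsub>K\<^esub>}"
    hence "x i = \<zero>\<^bsub>K\<^esub>" using assms(5) by auto
    with i bb show "x i \<odot>\<^bsub>T\<^esub> b i = \<zero>\<^bsub>T\<^esub>" by simp
  qed (use bb xA in simp_all)
qed

lemma formal_sum_hom:
  assumes T: "module K T" and b: "b \<in> S \<rightarrow> carrier T"
  shows "formal_sum K T S b \<in> module_hom K (free_space K S) T"
proof -
  interpret T: module K T by fact
  note fs = free_space_simps[OF T.is_cring]
  interpret F: module K "free_space K S" by (rule free_space_module) (rule T.is_cring)
  have x: "x i \<in> carrier K" if "x \<in> carrier (free_space K S)" "i \<in> S" for i x using that by (auto simp: fs)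
  note bb = funcset_mem[OF b]
  show ?thesis unfolding module_hom_def
  proof (safe)
    fix x assume xc: "x \<in> carrier (free_space K S)"
    show "formal_sum K T S b x \<in> carrier T"
      unfolding formal_sum_def by (rule T.M.add.finprod_closed) (use x[OF xc] bb in auto)
    fix r assume r: "r \<in> carrier K"
    let ?A = "{i \<in> S. x i \<noteq> \<zero>\<^bsub>K\<^esub>}"
    have fin: "finite ?A" using xc by (simp add: fs)
    have "formal_sum K T S b (r \<odot>\<^bsub>free_space K S\<^esub> x) = (\<Oplus>\<^bsub>T\<^esub>p\<in>?A. (r \<odot>\<^bsub>free_space K S\<^esub> x) p \<odot>\<^bsub>T\<^esub> b p)"
      by (rule formal_sum_over[OF T b F.smult_closed[OF r xc] fin]) (auto simp: fs r)
    also have "\<dots> = (\<Oplus>\<^bsub>T\<^esub>p\<in>?A. r \<odot>\<^bsub>T\<^esub> (x p \<odot>\<^bsub>T\<^esub> b p))"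
      by (rule T.M.add.finprod_cong') (use x[OF xc] bb r in \<open>auto simp: fs T.smult_assoc1\<close>)
    also have "\<dots> = r \<odot>\<^bsub>T\<^esub> (\<Oplus>\<^bsub>T\<^esub>p\<in>?A. x p \<odot>\<^bsub>T\<^esub> b p)"
      by (rule T.finsum_smult[symmetric]) (use fin r x[OF xc] bb in auto)
    finally show "formal_sum K T S b (r \<odot>\<^bsub>free_space K S\<^esub> x) = r \<odot>\<^bsub>T\<^esub> formal_sum K T S b x" by (simp add: formal_sum_def)
  next
    fix x y assume xc: "x \<in> carrier (free_space K S)" and yc: "y \<in> carrier (free_space K S)"
    let ?A = "{i \<in> S. x i \<noteq> \<zero>\<^bsub>K\<^esub>} \<union> {i \<in> S. y i \<noteq> \<zero>\<^bsub>K\<^esub>}"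
    have fin: "finite ?A" using xc yc by (simp add: fs)
    have "formal_sum K T S b (x \<oplus>\<^bsub>free_space K S\<^esub> y) = (\<Oplus>\<^bsub>T\<^esub>p\<in>?A. (x \<oplus>\<^bsub>free_space K S\<^esub> y) p \<odot>\<^bsub>T\<^esub> b p)"
      by (rule formal_sum_over[OF T b F.M.a_closed[OF xc yc] fin]) (auto simp: fs)
    also have "\<dots> = (\<Oplus>\<^bsub>T\<^esub>p\<in>?A. x p \<odot>\<^bsub>T\<^esub> b p \<oplus>\<^bsub>T\<^esub> y p \<odot>\<^bsub>T\<^esub> b p)"
      by (rule T.M.add.finprod_cong') (use x[OF xc] x[OF yc] bb in \<open>auto simp: fs T.smult_l_distr\<close>)
    also have "\<dots> = (\<Oplus>\<^bsub>T\<^esub>p\<in>?A. x p \<odot>\<^bsub>T\<^esub> b p) \<oplus>\<^bsub>T\<^esub> (\<Oplus>\<^bsub>T\<^esub>p\<in>?A. y p \<odot>\<^bsub>T\<^esub> b p)"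
      by (rule T.M.finsum_addf) (use x[OF xc] x[OF yc] bb in auto)
    also have "(\<Oplus>\<^bsub>T\<^esub>p\<in>?A. x p \<odot>\<^bsub>T\<^esub> b p) = formal_sum K T S b x"
      by (rule formal_sum_over[OF T b xc fin, symmetric]) auto
    also have "(\<Oplus>\<^bsub>T\<^esub>p\<in>?A. y p \<odot>\<^bsub>T\<^esub> b p) = formal_sum K T S b y"
      by (rule formal_sum_over[OF T b yc fin, symmetric]) auto
    finally show "formal_sum K T S b (x \<oplus>\<^bsub>free_space K S\<^esub> y) = formal_sum K T S b x \<oplus>\<^bsub>T\<^esub> formal_sum K T S b y" .
  qed
qed

lemma formal_sum_gen:
  assumes T: "module K T" and b: "b \<in> S \<rightarrow> carrier T" and i: "i \<in> S"
  shows "formal_sum K T S b (free_gen K S i) = b i"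
proof -
  interpret T: module K T by fact
  have "formal_sum K T S b (free_gen K S i) = (\<Oplus>\<^bsub>T\<^esub>p\<in>{i}. free_gen K S i p \<odot>\<^bsub>T\<^esub> b p)"
    by (rule formal_sum_over[OF T b free_gen_carrier]) (use i T.is_cring in \<open>auto simp: free_gen_def\<close>)
  thus ?thesis using funcset_mem[OF b i] i by (simp add: free_gen_def)
qed

locale tensor_factors = M: module K M + N: module K N
  for K :: "('k, 'r) ring_scheme" and M :: "('k, 'm, 'a) module_scheme"
   and N :: "('k, 'n, 'b) module_scheme"
begin

abbreviation "F \<equiv> pair_space K M N"
abbreviation "R \<equiv> tensor_kernel K M N"
abbreviation "d \<equiv> pair_gen K M N"

sublocale F: module K F unfolding pair_space_def by (rule free_space_module) (rule M.is_cring)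

lemma d_closed: "m \<in> carrier M \<Longrightarrow> n \<in> carrier N \<Longrightarrow> d m n \<in> carrier F"
  unfolding pair_gen_def pair_space_def by (rule free_gen_carrier) (auto intro: M.is_cring)

lemma rel_sub: "bilinear_relations K M N \<subseteq> carrier F"
  unfolding bilinear_relations_def Let_def
  by (auto intro!: F.M.minus_closed F.M.a_closed F.smult_closed d_closed)

lemma R_sub: "submodule K R F" unfolding tensor_kernel_def
  by (rule F.span_is_submodule[OF rel_sub])

lemma R_addsub: "additive_subgroup R F"
proof (rule additive_subgroupI, rule F.M.add.subgroupI)
  interpret S: submodule K R F by (rule R_sub)
  show "R \<subseteq> carrier F" by (rule S.subset)
  show "R \<noteq> {}" using S.zero_closed by blast
  fix a assume a: "a \<in> R"
  hence "(\<ominus>\<^bsub>K\<^esub> \<one>\<^bsub>K\<^esub>) \<odot>\<^bsub>F\<^esub> a \<in> R" by (intro S.smult_closed) auto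
  moreover have "(\<ominus>\<^bsub>K\<^esub> \<one>\<^bsub>K\<^esub>) \<odot>\<^bsub>F\<^esub> a = \<ominus>\<^bsub>F\<^esub> a"
    using F.smult_minus_1 a S.subset by blast
  ultimately show "\<ominus>\<^bsub>F\<^esub> a \<in> R" by simp
  fix b assume "b \<in> R" thus "a \<oplus>\<^bsub>F\<^esub> b \<in> R" using a S.m_closed by simp
qed

sublocale Q: abelian_subgroup R F
  by (rule abelian_subgroupI3[OF R_addsub]) (rule F.abelian_group_axioms)

lemma coset_eq: "x \<in> carrier F \<Longrightarrow> y \<in> R +>\<^bsub>F\<^esub> x \<Longrightarrow> R +>\<^bsub>F\<^esub> y = R +>\<^bsub>F\<^esub> x"
  using F.M.a_repr_independence[OF _ _ Q.a_subgroup] by metis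

lemma coset_elem: "x \<in> carrier F \<Longrightarrow> y \<in> R +>\<^bsub>F\<^esub> x \<longleftrightarrow> (\<exists>r\<in>R. y = r \<oplus>\<^bsub>F\<^esub> x)"
  by (auto simp: a_r_coset_def')

lemma tensor_smult_coset: assumes "r \<in> carrier K" "x \<in> carrier F"
  shows "r \<odot>\<^bsub>tensor K M N\<^esub> (R +>\<^bsub>F\<^esub> x) = R +>\<^bsub>F\<^esub> (r \<odot>\<^bsub>F\<^esub> x)"
proof -
  have "R +>\<^bsub>F\<^esub> (r \<odot>\<^bsub>F\<^esub> y) = R +>\<^bsub>F\<^esub> (r \<odot>\<^bsub>F\<^esub> x)" if y: "y \<in> R +>\<^bsub>F\<^esub> x" for y
  proof (rule coset_eq)
    obtain s where s: "s \<in> R" "y = s \<oplus>\<^bsub>F\<^esub> x" using y assms coset_elem by auto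
    then have "s \<in> carrier F" using Q.a_subset by auto
    have "r \<odot>\<^bsub>F\<^esub> s \<in> R" using R_sub s assms by (auto simp: submodule_def)
    thus "r \<odot>\<^bsub>F\<^esub> y \<in> R +>\<^bsub>F\<^esub> (r \<odot>\<^bsub>F\<^esub> x)" 
      using s assms \<open>s \<in> carrier F\<close> by (auto simp: coset_elem F.smult_r_distr)
  qed (use assms in auto)
  moreover have "x \<in> R +>\<^bsub>F\<^esub> x" using Q.a_rcos_self assms by auto
  ultimately have "(\<Union>y\<in>R +>\<^bsub>F\<^esub> x. R +>\<^bsub>F\<^esub> (r \<odot>\<^bsub>F\<^esub> y)) = R +>\<^bsub>F\<^esub> (r \<odot>\<^bsub>F\<^esub> x)"
    by (intro UN_constant_eq[of x] ballI)
  thus ?thesis by (simp add: tensor_def Let_def)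
qed

lemma tensor_carrier: "carrier (tensor K M N) = (\<lambda>x. R +>\<^bsub>F\<^esub> x) ` carrier F"
  by (auto simp: tensor_def Let_def A_RCOSETS_def')

lemma tensor_add_coset: "x \<in> carrier F \<Longrightarrow> y \<in> carrier F \<Longrightarrow>
   (R +>\<^bsub>F\<^esub> x) \<oplus>\<^bsub>tensor K M N\<^esub> (R +>\<^bsub>F\<^esub> y) = R +>\<^bsub>F\<^esub> (x \<oplus>\<^bsub>F\<^esub> y)"
  by (simp add: tensor_def Let_def Q.a_rcos_sum)

lemma tensor_zero_coset: "\<zero>\<^bsub>tensor K M N\<^esub> = R +>\<^bsub>F\<^esub> \<zero>\<^bsub>F\<^esub>"
  using F.M.a_coset_add_zero[OF Q.a_subset] by (simp add: tensor_def Let_def)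

lemma tensor_module: "module K (tensor K M N)"
proof (rule module_criteria, goal_cases)
  case 4
  show ?case
  proof
    fix v assume "v \<in> carrier (tensor K M N)"
    then obtain x where x: "x \<in> carrier F" "v = R +>\<^bsub>F\<^esub> x" by (auto simp: tensor_carrier)
    show "\<exists>w\<in>carrier (tensor K M N). v \<oplus>\<^bsub>tensor K M N\<^esub> w = \<zero>\<^bsub>tensor K M N\<^esub>"
      by (rule bexI[of _ "R +>\<^bsub>F\<^esub> (\<ominus>\<^bsub>F\<^esub> x)"]) (use x in \<open>auto simp: tensor_carrier tensor_add_coset tensor_zero_coset F.M.r_neg\<close>)
  qed
qed (auto simp: tensor_carrier tensor_zero_coset tensor_add_coset tensor_smult_coset F.M.a_ac F.smult_l_distr F.smult_r_distr F.smult_assoc1 intro!: M.is_cring)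

lemma pure_tensor_add_left: "\<lbrakk>m \<in> carrier M; m' \<in> carrier M; n \<in> carrier N\<rbrakk> \<Longrightarrow>
  pure_tensor K M N (m \<oplus>\<^bsub>M\<^esub> m') n = pure_tensor K M N m n \<oplus>\<^bsub>tensor K M N\<^esub> pure_tensor K M N m' n"
proof -
  assume A: "m \<in> carrier M" "m' \<in> carrier M" "n \<in> carrier N"
  have "d (m \<oplus>\<^bsub>M\<^esub> m') n \<ominus>\<^bsub>F\<^esub> (d m n \<oplus>\<^bsub>F\<^esub> d m' n) \<in> bilinear_relations K M N"
    unfolding bilinear_relations_def Let_def using A by blast
  hence r: "d (m \<oplus>\<^bsub>M\<^esub> m') n \<ominus>\<^bsub>F\<^esub> (d m n \<oplus>\<^bsub>F\<^esub> d m' n) \<in> R"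
    unfolding tensor_kernel_def using F.in_own_span[OF rel_sub] by blast
  have "d (m \<oplus>\<^bsub>M\<^esub> m') n = (d (m \<oplus>\<^bsub>M\<^esub> m') n \<ominus>\<^bsub>F\<^esub> (d m n \<oplus>\<^bsub>F\<^esub> d m' n)) \<oplus>\<^bsub>F\<^esub> (d m n \<oplus>\<^bsub>F\<^esub> d m' n)"
    using A d_closed by (simp add: F.M.minus_eq F.M.a_assoc F.M.l_neg)
  hence "R +>\<^bsub>F\<^esub> d (m \<oplus>\<^bsub>M\<^esub> m') n = R +>\<^bsub>F\<^esub> (d m n \<oplus>\<^bsub>F\<^esub> d m' n)"
    by (intro coset_eq) (use A d_closed r in \<open>auto simp: coset_elem\<close>)
  thus ?thesis using A by (simp add: pure_tensor_def tensor_add_coset d_closed)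
qed

context
  fixes T :: "('k, 't, 'c) module_scheme" and b
  assumes T: "module K T" and bc: "b \<in> carrier M \<times> carrier N \<rightarrow> carrier T"
   and b1: "\<And>m m' n. \<lbrakk>m \<in> carrier M; m' \<in> carrier M; n \<in> carrier N\<rbrakk> \<Longrightarrow> b (m \<oplus>\<^bsub>M\<^esub> m', n) = b (m,n) \<oplus>\<^bsub>T\<^esub> b (m',n)"
   and b2: "\<And>m n n'. \<lbrakk>m \<in> carrier M; n \<in> carrier N; n' \<in> carrier N\<rbrakk> \<Longrightarrow> b (m, n \<oplus>\<^bsub>N\<^esub> n') = b (m,n) \<oplus>\<^bsub>T\<^esub> b (m,n')"
   and b3: "\<And>r m n. \<lbrakk>r \<in> carrier K; m \<in> carrier M; n \<in> carrier N\<rbrakk> \<Longrightarrow> b (r \<odot>\<^bsub>M\<^esub> m, n) = r \<odot>\<^bsub>T\<^esub> b (m,n)"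
   and b4: "\<And>r m n. \<lbrakk>r \<in> carrier K; m \<in> carrier M; n \<in> carrier N\<rbrakk> \<Longrightarrow> b (m, r \<odot>\<^bsub>N\<^esub> n) = r \<odot>\<^bsub>T\<^esub> b (m,n)"
begin

abbreviation "e \<equiv> formal_sum K T (carrier M \<times> carrier N) b"

interpretation E: mod_hom K F T e
  unfolding mod_hom_def mod_hom_axioms_def pair_space_def
  by (intro conjI T formal_sum_hom bc F.module_axioms[unfolded pair_space_def])

lemma e_d: "m \<in> carrier M \<Longrightarrow> n \<in> carrier N \<Longrightarrow> e (d m n) = b (m, n)"
  unfolding pair_gen_def by (rule formal_sum_gen[OF T bc]) auto

lemma e_R: "x \<in> R \<Longrightarrow> e x = \<zero>\<^bsub>T\<^esub>"
proof -
  have bcl: "b (m, n) \<in> carrier T" if "m \<in> carrier M" "n \<in> carrier N" for m n using that bc by auto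
  have "bilinear_relations K M N \<subseteq> E.ker"
    using rel_sub unfolding E.ker_def bilinear_relations_def Let_def
    by (auto simp: d_closed e_d b1 b2 b3 b4 bcl E.N.M.minus_eq E.N.M.r_neg)
  hence "R \<subseteq> E.ker" unfolding tensor_kernel_def by (rule F.span_is_subset) (rule E.ker_is_submodule)
  thus "x \<in> R \<Longrightarrow> e x = \<zero>\<^bsub>T\<^esub>" by (auto simp: E.ker_def)
qed

lemma tensor_lift_coset: assumes "x \<in> carrier F"
  shows "tensor_lift K M N T b (R +>\<^bsub>F\<^esub> x) = e x"
proof -
  have "e y = e x" if y: "y \<in> R +>\<^bsub>F\<^esub> x" for y
  proof -
    obtain s where s: "s \<in> R" "y = s \<oplus>\<^bsub>F\<^esub> x" using y assms coset_elem by auto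
    then have "s \<in> carrier F" using Q.a_subset by auto
    thus ?thesis using s assms e_R by simp
  qed
  moreover have "x \<in> R +>\<^bsub>F\<^esub> x" using Q.a_rcos_self assms by auto
  ultimately have "e ` (R +>\<^bsub>F\<^esub> x) = (\<lambda>_. e x) ` (R +>\<^bsub>F\<^esub> x)" "R +>\<^bsub>F\<^esub> x \<noteq> {}"
    by (blast intro: image_cong, blast)
  hence "e ` (R +>\<^bsub>F\<^esub> x) = {e x}" by (simp add: image_constant_conv)
  thus ?thesis by (simp add: tensor_lift_def formal_sum_def[abs_def])
qed

lemma tensor_lift_pure: "m \<in> carrier M \<Longrightarrow> n \<in> carrier N \<Longrightarrow> 
   tensor_lift K M N T b (pure_tensor K M N m n) = b (m, n)"
  by (simp add: pure_tensor_def tensor_lift_coset d_closed e_d)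

lemma tensor_lift_hom: "tensor_lift K M N T b \<in> module_hom K (tensor K M N) T"
  unfolding module_hom_def
  by (auto simp: tensor_carrier tensor_lift_coset tensor_add_coset tensor_smult_coset)

end

end


section \<open>Hom-bialgebras and Yetter--Drinfeld modules\<close>

locale hom_bialgebra_data = vectorspace K H
  for K :: "('k, 'r) ring_scheme" and H :: "('k, 'h, 'a) module_scheme" +
  fixes \<mu> :: "('h \<times> 'h \<Rightarrow> 'k) set \<Rightarrow> 'h"
    and \<Delta> :: "'h \<Rightarrow> ('h \<times> 'h \<Rightarrow> 'k) set"
    and \<alpha> :: "'h \<Rightarrow> 'h"
begin

abbreviation hmult :: "'h \<Rightarrow> 'h \<Rightarrow> 'h" (infixl \<open>\<star>\<close> 70) where
  "h \<star> h' \<equiv> \<mu> (pure_tensor K H H h h')"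

end

locale hom_bialgebra = hom_bialgebra_data +
  assumes mu_linear: "\<mu> \<in> module_hom K (tensor K H H) H"
    and Delta_linear: "\<Delta> \<in> module_hom K H (tensor K H H)"
    and alpha_linear: "\<alpha> \<in> module_hom K H H"
    and alpha_mult: "\<lbrakk>h \<in> carrier H; h' \<in> carrier H\<rbrakk> \<Longrightarrow> \<alpha> (h \<star> h') = \<alpha> h \<star> \<alpha> h'"
    and hom_assoc: "\<lbrakk>h \<in> carrier H; h' \<in> carrier H; h'' \<in> carrier H\<rbrakk> \<Longrightarrow>
      \<alpha> h \<star> (h' \<star> h'') = (h \<star> h') \<star> \<alpha> h''"
    and hom_coassoc: "h \<in> carrier H \<Longrightarrow>
      tensor_assoc K H H H (tensor_map K H H (tensor K H H) H \<Delta> \<alpha> (\<Delta> h)) =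
      tensor_map K H H H (tensor K H H) \<alpha> \<Delta> (\<Delta> h)"
    and Delta_mult: "\<lbrakk>h \<in> carrier H; h' \<in> carrier H\<rbrakk> \<Longrightarrow>
      \<Delta> (h \<star> h') =
      tensor_lift K H H (tensor K H H) (\<lambda>(h1, h2).
        tensor_lift K H H (tensor K H H) (\<lambda>(h1', h2').
          pure_tensor K H H (h1 \<star> h1') (h2 \<star> h2')) (\<Delta> h')) (\<Delta> h)"
    and Delta_alpha: "h \<in> carrier H \<Longrightarrow> \<Delta> (\<alpha> h) = tensor_map K H H H H \<alpha> \<alpha> (\<Delta> h)"

locale hom_module_data = hom_bialgebra K H \<mu> \<Delta> \<alpha> + M: vectorspace K M
  for K :: "('k, 'r) ring_scheme" and H :: "('k, 'h, 'a) module_scheme" and \<mu> \<Delta> \<alpha>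
    and M :: "('k, 'm, 'b) module_scheme" +
  fixes \<alpha>\<^sub>M :: "'m \<Rightarrow> 'm"
    and act :: "('h \<times> 'm \<Rightarrow> 'k) set \<Rightarrow> 'm"
begin

abbreviation action :: "'h \<Rightarrow> 'm \<Rightarrow> 'm" (infixr \<open>\<rhd>\<close> 75) where
  "h \<rhd> m \<equiv> act (pure_tensor K H M h m)"

end

locale hom_module = hom_module_data +
  assumes alphaM_linear: "\<alpha>\<^sub>M \<in> module_hom K M M"
    and act_linear: "act \<in> module_hom K (tensor K H M) M"
    and alpha_act: "\<lbrakk>h \<in> carrier H; m \<in> carrier M\<rbrakk> \<Longrightarrow> \<alpha>\<^sub>M (h \<rhd> m) = \<alpha> h \<rhd> \<alpha>\<^sub>M m"
    and act_act: "\<lbrakk>h \<in> carrier H; h' \<in> carrier H; m \<in> carrier M\<rbrakk> \<Longrightarrow>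
      \<alpha> h \<rhd> (h' \<rhd> m) = (h \<star> h') \<rhd> \<alpha>\<^sub>M m"

locale hom_comodule = hom_bialgebra K H \<mu> \<Delta> \<alpha> + M: vectorspace K M
  for K :: "('k, 'r) ring_scheme" and H :: "('k, 'h, 'a) module_scheme" and \<mu> \<Delta> \<alpha>
    and M :: "('k, 'm, 'b) module_scheme" +
  fixes \<alpha>\<^sub>M :: "'m \<Rightarrow> 'm"
    and coact :: "'m \<Rightarrow> ('h \<times> 'm \<Rightarrow> 'k) set"
  assumes alphaM_linear: "\<alpha>\<^sub>M \<in> module_hom K M M"
    and coact_linear: "coact \<in> module_hom K M (tensor K H M)"
    and alpha_coact: "m \<in> carrier M \<Longrightarrow>
      tensor_map K H M H M \<alpha> \<alpha>\<^sub>M (coact m) = coact (\<alpha>\<^sub>M m)"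
    and coact_coact: "m \<in> carrier M \<Longrightarrow>
      tensor_assoc K H H M (tensor_map K H M (tensor K H H) M \<Delta> \<alpha>\<^sub>M (coact m)) =
      tensor_map K H M H (tensor K H M) \<alpha> coact (coact m)"

locale yetter_drinfeld_module =
  hom_module K H \<mu> \<Delta> \<alpha> M \<alpha>\<^sub>M act + comodule: hom_comodule K H \<mu> \<Delta> \<alpha> M \<alpha>\<^sub>M coact
  for K :: "('k, 'r) ring_scheme" and H :: "('k, 'h, 'a) module_scheme" and \<mu> \<Delta> \<alpha>
    and M :: "('k, 'm, 'b) module_scheme" and \<alpha>\<^sub>M act coact +
  assumes yetter_drinfeld: "\<lbrakk>h \<in> carrier H; m \<in> carrier M\<rbrakk> \<Longrightarrow>
      tensor_lift K H H (tensor K H M) (\<lambda>(h1, h2).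
        tensor_lift K H M (tensor K H M) (\<lambda>(a, x).
          pure_tensor K H M (a \<star> \<alpha> (\<alpha> h2)) x) (coact (h1 \<rhd> m))) (\<Delta> h) =
      tensor_lift K H H (tensor K H M) (\<lambda>(h1, h2).
        tensor_lift K H M (tensor K H M) (\<lambda>(a, x).
          pure_tensor K H M (\<alpha> (\<alpha> h1) \<star> \<alpha> a) (\<alpha> h2 \<rhd> x)) (coact m)) (\<Delta> h)"

definition yd_braiding ::
  "('k, 'r) ring_scheme \<Rightarrow> ('k, 'h, 'a) module_scheme \<Rightarrow> ('h \<Rightarrow> 'h)
   \<Rightarrow> ('k, 'm, 'b) module_scheme \<Rightarrow> ('m \<Rightarrow> ('h \<times> 'm \<Rightarrow> 'k) set)
   \<Rightarrow> ('k, 'n, 'c) module_scheme \<Rightarrow> (('h \<times> 'n \<Rightarrow> 'k) set \<Rightarrow> 'n)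
   \<Rightarrow> ('m \<times> 'n \<Rightarrow> 'k) set \<Rightarrow> ('n \<times> 'm \<Rightarrow> 'k) set" where
  "yd_braiding K H \<alpha> M coactM N actN =
     tensor_lift K M N (tensor K N M) (\<lambda>(m, n).
       tensor_lift K H M (tensor K N M) (\<lambda>(a, x).
         pure_tensor K N M (actN (pure_tensor K H N (inv_into (carrier H) \<alpha> a) n)) x)
         (coactM m))"

end

theory Submission
  imports Defs
begin

text \<open>
  Linear maps out of \<open>M \<otimes> (N \<otimes> P)\<close> are determined by their values on pure tensors. Both sides of the
  Hom-Yang--Baxter equation send \<open>m \<otimes> (n \<otimes> p)\<close> to
  \<open>(g\<^sub>1 n\<^sub>(\<^sub>-\<^sub>1\<^sub>)) \<cdot> \<alpha>\<^sup>2(p) \<otimes> (\<alpha>(g\<^sub>2) \<cdot> \<alpha>(n\<^sub>(\<^sub>0\<^sub>)) \<otimes> \<alpha>\<^sup>2(m\<^sub>(\<^sub>0\<^sub>)))\<close> with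
  \<open>g = \<alpha>\<^sup>-\<^sup>1(m\<^sub>(\<^sub>-\<^sub>1\<^sub>))\<close>. On either side, Hom-coassociativity of the coaction on \<open>M\<close> replaces
  the iterated coaction by \<open>\<Delta>(m\<^sub>(\<^sub>-\<^sub>1\<^sub>))\<close>; on the right, where the coaction of
  \<open>g\<^sub>1 \<cdot> \<alpha>(n)\<close> occurs, the Yetter--Drinfeld condition of \<open>N\<close>, pushed through \<open>\<alpha>\<^sup>-\<^sup>2\<close>, does the rest.
\<close>

section \<open>Linear and bilinear maps\<close>

lemma mod_hom_iff: "mod_hom K A B f \<longleftrightarrow> module K A \<and> module K B \<and> f \<in> module_hom K A B"
  by (auto simp: mod_hom_def mod_hom_axioms_def)

lemma mod_hom_closed: "mod_hom K A B f \<Longrightarrow> x \<in> carrier A \<Longrightarrow> f x \<in> carrier B"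
  by (rule mod_hom.f_im)

lemma mod_hom_add:
  "mod_hom K A B f \<Longrightarrow> x \<in> carrier A \<Longrightarrow> y \<in> carrier A \<Longrightarrow> f (x \<oplus>\<^bsub>A\<^esub> y) = f x \<oplus>\<^bsub>B\<^esub> f y"
  by (simp add: mod_hom_iff module_hom_def)

lemma mod_hom_smult:
  "mod_hom K A B f \<Longrightarrow> r \<in> carrier K \<Longrightarrow> x \<in> carrier A \<Longrightarrow> f (r \<odot>\<^bsub>A\<^esub> x) = r \<odot>\<^bsub>B\<^esub> f x"
  by (simp add: mod_hom_iff module_hom_def)

lemma mod_hom_cong:
  assumes "mod_hom K A B f" "\<And>x. x \<in> carrier A \<Longrightarrow> f x = g x"
  shows "mod_hom K A B g"
proof -
  interpret f: mod_hom K A B f by fact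
  have "g x \<in> carrier B" if "x \<in> carrier A" for x
    using assms(2)[OF that] that f.f_im by metis
  moreover have "g (x \<oplus>\<^bsub>A\<^esub> y) = g x \<oplus>\<^bsub>B\<^esub> g y" if "x \<in> carrier A" "y \<in> carrier A" for x y
    using that assms(2)[symmetric] by simp
  moreover have "g (r \<odot>\<^bsub>A\<^esub> x) = r \<odot>\<^bsub>B\<^esub> g x" if "r \<in> carrier K" "x \<in> carrier A" for r x
    using that assms(2)[symmetric] by simp
  ultimately show ?thesis
    unfolding mod_hom_iff module_hom_def using f.M.module_axioms f.N.module_axioms by auto
qed

lemma mod_hom_ident: "module K A \<Longrightarrow> mod_hom K A A (\<lambda>x. x)"
  by (auto simp: mod_hom_iff module_hom_def)

lemma mod_hom_compose:
  assumes "mod_hom K B C g" "mod_hom K A B f"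
  shows "mod_hom K A C (\<lambda>x. g (f x))"
proof -
  interpret f: mod_hom K A B f by fact
  interpret g: mod_hom K B C g by fact
  show ?thesis
    using f.M.module_axioms g.N.module_axioms by (auto simp: mod_hom_iff module_hom_def)
qed

lemma mod_hom_inv_into:
  assumes "mod_hom K A B f" "bij_betw f (carrier A) (carrier B)"
  shows "mod_hom K B A (inv_into (carrier A) f)"
proof -
  interpret f: mod_hom K A B f by fact
  note [simp] = bij_betw_inv_into_right[OF assms(2)]
  have cl: "inv_into (carrier A) f y \<in> carrier A" if "y \<in> carrier B" for y
    using bij_betw_apply[OF bij_betw_inv_into[OF assms(2)] that] .
  \<comment> \<open>Used as an introduction rule: an identity for the inverse is reduced to the
    corresponding identity for \<open>f\<close>, which linearity of \<open>f\<close>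
    settles.\<close>
  have eq: "inv_into (carrier A) f y = x" if "x \<in> carrier A" "f x = y" for x y
    using bij_betw_inv_into_left[OF assms(2)] that by auto
  show ?thesis
    unfolding mod_hom_iff module_hom_def
    using f.M.module_axioms f.N.module_axioms by (auto simp: cl intro!: eq)
qed

section \<open>Bilinear maps and the universal property of the tensor product\<close>

definition bilinear_map where
  "bilinear_map K A B T b \<longleftrightarrow> module K A \<and> module K B \<and> module K T \<and>
     (\<forall>x\<in>carrier A. mod_hom K B T (\<lambda>y. b x y)) \<and> (\<forall>y\<in>carrier B. mod_hom K A T (\<lambda>x. b x y))"

lemma bilinear_mapI:
  assumes "module K A" "module K B" "module K T"
    and "\<And>x. x \<in> carrier A \<Longrightarrow> mod_hom K B T (\<lambda>y. b x y)"
    and "\<And>y. y \<in> carrier B \<Longrightarrow> mod_hom K A T (\<lambda>x. b x y)"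
  shows "bilinear_map K A B T b"
  using assms by (simp add: bilinear_map_def)

lemma bilinear_map_closed:
  "bilinear_map K A B T b \<Longrightarrow> x \<in> carrier A \<Longrightarrow> y \<in> carrier B \<Longrightarrow> b x y \<in> carrier T"
  by (auto simp: bilinear_map_def intro: mod_hom_closed)

lemma bilinear_map_cong:
  assumes "bilinear_map K A B T b"
    and "\<And>x y. x \<in> carrier A \<Longrightarrow> y \<in> carrier B \<Longrightarrow> b x y = b' x y"
  shows "bilinear_map K A B T b'"
  using assms unfolding bilinear_map_def by (auto intro: mod_hom_cong)

text \<open>Linearity in each argument supplies the four bilinearity conditions under which a lift
  is independent of the coset representative. In this form the universal property serves all
  Sweedler expressions below.\<close>

lemma
  assumes "bilinear_map K A B T b"
  shows mod_hom_tensor_lift: "mod_hom K (tensor K A B) T (tensor_lift K A B T (\<lambda>(x, y). b x y))"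
    and tensor_lift_pure_tensor: "\<And>x y. x \<in> carrier A \<Longrightarrow> y \<in> carrier B \<Longrightarrow>
      tensor_lift K A B T (\<lambda>(x, y). b x y) (pure_tensor K A B x y) = b x y"
proof -
  have mods: "module K A" "module K B" and T: "module K T"
    using assms by (auto simp: bilinear_map_def)
  interpret tensor_factors K A B by (intro tensor_factors.intro mods)
  have b: "case_prod b \<in> carrier A \<times> carrier B \<rightarrow> carrier T"
    using bilinear_map_closed[OF assms] by auto
  have l: "mod_hom K B T (\<lambda>y. b x y)" if "x \<in> carrier A" for x
    using assms that by (simp add: bilinear_map_def)
  have r: "mod_hom K A T (\<lambda>x. b x y)" if "y \<in> carrier B" for y
    using assms that by (simp add: bilinear_map_def)
  note eqs = mod_hom_add[OF r] mod_hom_add[OF l] mod_hom_smult[OF r] mod_hom_smult[OF l]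
  have "tensor_lift K A B T (case_prod b) \<in> module_hom K (tensor K A B) T"
    by (rule tensor_lift_hom[OF T b]) (simp_all add: eqs)
  then show "mod_hom K (tensor K A B) T (tensor_lift K A B T (\<lambda>(x, y). b x y))"
    by (simp add: mod_hom_iff T tensor_module)
  fix x y assume "x \<in> carrier A" "y \<in> carrier B"
  then have "tensor_lift K A B T (case_prod b) (pure_tensor K A B x y) = case_prod b (x, y)"
    by (intro tensor_lift_pure[OF T b]) (simp_all add: eqs)
  then show "tensor_lift K A B T (\<lambda>(x, y). b x y) (pure_tensor K A B x y) = b x y"
    by simp
qed

lemma module_tensor: "module K A \<Longrightarrow> module K B \<Longrightarrow> module K (tensor K A B)"
  by (simp add: tensor_factors.tensor_module tensor_factors_def)

text \<open>Each bilinearity identity equates two cosets whose representatives differ by one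
  generating relation of \<open>tensor_kernel\<close>; for additivity on the left this is
  \<open>pure_tensor_add_left\<close>.\<close>

lemma bilinear_pure_tensor:
  assumes "module K A" "module K B"
  shows "bilinear_map K A B (tensor K A B) (\<lambda>x y. pure_tensor K A B x y)"
proof -
  interpret tensor_factors K A B by (intro tensor_factors.intro assms)
  have coset: "R +>\<^bsub>F\<^esub> u = R +>\<^bsub>F\<^esub> v"
    if "u \<ominus>\<^bsub>F\<^esub> v \<in> bilinear_relations K A B" "u \<in> carrier F" "v \<in> carrier F" for u v
  proof (rule coset_eq[OF that(3)])
    have "u \<ominus>\<^bsub>F\<^esub> v \<in> R"
      unfolding tensor_kernel_def using F.in_own_span[OF rel_sub] that(1) by blast
    moreover have "u = (u \<ominus>\<^bsub>F\<^esub> v) \<oplus>\<^bsub>F\<^esub> v"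
      using that by (simp add: F.M.minus_eq F.M.a_assoc F.M.l_neg)
    ultimately show "u \<in> R +>\<^bsub>F\<^esub> v" using that coset_elem by blast
  qed
  have closed: "pure_tensor K A B x y \<in> carrier (tensor K A B)"
    if "x \<in> carrier A" "y \<in> carrier B" for x y
    using that by (auto simp: pure_tensor_def tensor_carrier d_closed)
  have add: "pure_tensor K A B x (y \<oplus>\<^bsub>B\<^esub> y') =
      pure_tensor K A B x y \<oplus>\<^bsub>tensor K A B\<^esub> pure_tensor K A B x y'"
    if "x \<in> carrier A" "y \<in> carrier B" "y' \<in> carrier B" for x y y'
    unfolding pure_tensor_def using that
    by (subst tensor_add_coset, simp_all add: d_closed, intro coset)
       (simp_all add: d_closed, auto simp: bilinear_relations_def Let_def)
  have smult_left: "pure_tensor K A B (r \<odot>\<^bsub>A\<^esub> x) y =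
      r \<odot>\<^bsub>tensor K A B\<^esub> pure_tensor K A B x y"
    if "r \<in> carrier K" "x \<in> carrier A" "y \<in> carrier B" for r x y
    unfolding pure_tensor_def using that
    by (subst tensor_smult_coset, simp_all add: d_closed, intro coset)
       (simp_all add: d_closed, auto simp: bilinear_relations_def Let_def)
  have smult_right: "pure_tensor K A B x (r \<odot>\<^bsub>B\<^esub> y) =
      r \<odot>\<^bsub>tensor K A B\<^esub> pure_tensor K A B x y"
    if "r \<in> carrier K" "x \<in> carrier A" "y \<in> carrier B" for r x y
    unfolding pure_tensor_def using that
    by (subst tensor_smult_coset, simp_all add: d_closed, intro coset)
       (simp_all add: d_closed, auto simp: bilinear_relations_def Let_def)
  show ?thesis
    by (auto simp: bilinear_map_def assms tensor_module mod_hom_iff module_hom_def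
        closed pure_tensor_add_left add smult_left smult_right)
qed

lemma pure_tensor_closed:
  assumes "module K A" "module K B" "x \<in> carrier A" "y \<in> carrier B"
  shows "pure_tensor K A B x y \<in> carrier (tensor K A B)"
  using bilinear_map_closed[OF bilinear_pure_tensor] assms .

text \<open>Induction over a finite set containing the support: splitting off the coefficient at one
  point leaves a vector supported in a smaller set.\<close>

lemma free_space_hom_eq:
  assumes f: "mod_hom K (free_space K S) T f" and g: "mod_hom K (free_space K S) T g"
    and gen: "\<And>i. i \<in> S \<Longrightarrow> f (free_gen K S i) = g (free_gen K S i)"
    and x: "x \<in> carrier (free_space K S)"
  shows "f x = g x"
proof -
  interpret f: mod_hom K "free_space K S" T f by fact
  interpret g: mod_hom K "free_space K S" T g by fact
  have cring: "cring K" using f by (simp add: mod_hom_iff module_def)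
  interpret K: cring K by (rule cring)
  note fs = free_space_simps[OF cring]
  \<comment> \<open>The set \<open>I\<close> need only contain the support, so the induction may
    also remove points where \<open>x\<close> vanishes or that lie outside \<open>S\<close>.\<close>
  have "f x = g x" if "finite I" "x \<in> carrier (free_space K S)" "{i \<in> S. x i \<noteq> \<zero>\<^bsub>K\<^esub>} \<subseteq> I" for I x
    using that
  proof (induction I arbitrary: x rule: finite_induct)
    case empty
    \<comment> \<open>Outside \<open>S\<close> both functions are \<open>undefined\<close> by
      extensionality, so they agree as functions and not only in their coefficients.\<close>
    then have "x = \<zero>\<^bsub>free_space K S\<^esub>"
      by (intro ext) (auto simp: fs PiE_def extensional_def)
    then show ?case by simp
  next
    case (insert a I)
    show ?case
    proof (cases "a \<in> S")
      case False
      with insert.prems show ?thesis by (intro insert.IH) auto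
    next
      case True
      define y where "y = x(a := \<zero>\<^bsub>K\<^esub>)"
      have xc: "x i \<in> carrier K" if "i \<in> S" for i
        using insert.prems(1) that by (auto simp: fs)
      have "finite {i \<in> S. y i \<noteq> \<zero>\<^bsub>K\<^esub>}"
        by (rule finite_subset[of _ "{i \<in> S. x i \<noteq> \<zero>\<^bsub>K\<^esub>}"])
           (use insert.prems(1) in \<open>auto simp: fs y_def\<close>)
      then have y: "y \<in> carrier (free_space K S)"
        using insert.prems(1) True by (auto simp: fs y_def PiE_def extensional_def)
      have x: "y \<oplus>\<^bsub>free_space K S\<^esub> x a \<odot>\<^bsub>free_space K S\<^esub> free_gen K S a = x"
        using insert.prems(1) True xc
        by (intro ext) (auto simp: fs y_def free_gen_def PiE_def extensional_def)
      have "f y = g y" using insert.prems(2) by (intro insert.IH y) (auto simp: y_def)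
      moreover have "free_gen K S a \<in> carrier (free_space K S)" by (rule free_gen_carrier[OF cring True])
      ultimately have "f (y \<oplus>\<^bsub>free_space K S\<^esub> x a \<odot>\<^bsub>free_space K S\<^esub> free_gen K S a) =
          g (y \<oplus>\<^bsub>free_space K S\<^esub> x a \<odot>\<^bsub>free_space K S\<^esub> free_gen K S a)"
        using y xc[OF True] gen[OF True]
        by (simp add: mod_hom_add[OF f] mod_hom_add[OF g] mod_hom_smult[OF f] mod_hom_smult[OF g])
      then show ?thesis by (simp only: x)
    qed
  qed
  with x show ?thesis by (auto simp: fs)
qed

text \<open>Composition with the quotient map from the free space turns the free generators into
  pure tensors, so uniqueness on the free space descends. Identities between maps out of a tensor
  product are proved this way throughout.\<close>

lemma tensor_hom_eq:
  assumes f: "mod_hom K (tensor K A B) T f" and g: "mod_hom K (tensor K A B) T g"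
    and mods: "module K A" "module K B"
    and pure: "\<And>x y. x \<in> carrier A \<Longrightarrow> y \<in> carrier B \<Longrightarrow>
      f (pure_tensor K A B x y) = g (pure_tensor K A B x y)"
    and t: "t \<in> carrier (tensor K A B)"
  shows "f t = g t"
proof -
  interpret tensor_factors K A B by (intro tensor_factors.intro mods)
  have proj: "mod_hom K F (tensor K A B) (\<lambda>x. R +>\<^bsub>F\<^esub> x)"
    by (auto simp: mod_hom_iff module_hom_def tensor_module F.module_axioms tensor_carrier
        tensor_add_coset tensor_smult_coset)
  obtain x where x: "x \<in> carrier F" "t = R +>\<^bsub>F\<^esub> x" using t by (auto simp: tensor_carrier)
  have "f (R +>\<^bsub>F\<^esub> x) = g (R +>\<^bsub>F\<^esub> x)"
  proof (rule free_space_hom_eq[where f = "\<lambda>x. f (R +>\<^bsub>F\<^esub> x)" and g = "\<lambda>x. g (R +>\<^bsub>F\<^esub> x)"])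
    show "mod_hom K (free_space K (carrier A \<times> carrier B)) T (\<lambda>x. f (R +>\<^bsub>F\<^esub> x))"
      "mod_hom K (free_space K (carrier A \<times> carrier B)) T (\<lambda>x. g (R +>\<^bsub>F\<^esub> x))"
      using mod_hom_compose[OF f proj] mod_hom_compose[OF g proj] by (simp_all add: pair_space_def)
    show "f (R +>\<^bsub>F\<^esub> free_gen K (carrier A \<times> carrier B) p) =
        g (R +>\<^bsub>F\<^esub> free_gen K (carrier A \<times> carrier B) p)" if "p \<in> carrier A \<times> carrier B" for p
      using that pure by (auto simp: pure_tensor_def pair_gen_def)
  qed (use x in \<open>simp add: pair_space_def\<close>)
  then show ?thesis by (simp add: x)
qed

section \<open>Calculus of tensor lifts\<close>

lemma mod_hom_plus:
  assumes "mod_hom K A B f" "mod_hom K A B g"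
  shows "mod_hom K A B (\<lambda>x. f x \<oplus>\<^bsub>B\<^esub> g x)"
proof -
  interpret f: mod_hom K A B f by fact
  interpret g: mod_hom K A B g by fact
  show ?thesis
    using f.M.module_axioms f.N.module_axioms
    by (simp add: mod_hom_iff module_hom_def f.N.M.a_ac f.N.smult_r_distr)
qed

text \<open>Homogeneity moves a scalar past \<open>r\<close>, so commutativity of \<open>K\<close>
  enters here.\<close>

lemma mod_hom_scale:
  assumes "mod_hom K A B f" "r \<in> carrier K"
  shows "mod_hom K A B (\<lambda>x. r \<odot>\<^bsub>B\<^esub> f x)"
proof -
  interpret K: cring K using assms(1) by (simp add: mod_hom_iff module_def)
  interpret f: mod_hom K A B f by fact
  show ?thesis
    using assms(2) f.M.module_axioms f.N.module_axioms
    by (simp add: mod_hom_iff module_hom_def f.N.smult_r_distr K.m_comm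
        flip: f.N.smult_assoc1)
qed

lemma bilinear_map_comp_left:
  assumes "mod_hom K T U f" "bilinear_map K A B T b"
  shows "bilinear_map K A B U (\<lambda>x y. f (b x y))"
proof (rule bilinear_mapI)
  show "mod_hom K B U (\<lambda>y. f (b x y))" if "x \<in> carrier A" for x
    using assms that by (intro mod_hom_compose[OF assms(1)]) (simp add: bilinear_map_def)
  show "mod_hom K A U (\<lambda>x. f (b x y))" if "y \<in> carrier B" for y
    using assms that by (intro mod_hom_compose[OF assms(1)]) (simp add: bilinear_map_def)
qed (use assms in \<open>auto simp: bilinear_map_def mod_hom_iff\<close>)

lemma bilinear_map_comp_right:
  assumes "bilinear_map K A B T b" "mod_hom K C A f" "mod_hom K D B g"
  shows "bilinear_map K C D T (\<lambda>x y. b (f x) (g y))"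
proof (rule bilinear_mapI)
  show "mod_hom K D T (\<lambda>y. b (f x) (g y))" if "x \<in> carrier C" for x
    using assms that by (intro mod_hom_compose[OF _ assms(3)]) (simp add: bilinear_map_def mod_hom_closed)
  show "mod_hom K C T (\<lambda>x. b (f x) (g y))" if "y \<in> carrier D" for y
    using assms that
    by (intro mod_hom_compose[where g = "\<lambda>x. b x (g y)", OF _ assms(2)]) (simp add: bilinear_map_def mod_hom_closed)
qed (use assms in \<open>auto simp: bilinear_map_def mod_hom_iff\<close>)

text \<open>Rewriting under a Sweedler sum. Bilinearity of \<open>b'\<close> is inherited from
  \<open>b\<close>, so a rewriting step has to establish it on one side only.\<close>

lemma tensor_lift_cong:
  assumes b: "bilinear_map K A B T b" and t: "t \<in> carrier (tensor K A B)"
    and eq: "\<And>x y. x \<in> carrier A \<Longrightarrow> y \<in> carrier B \<Longrightarrow> b x y = b' x y"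
  shows "tensor_lift K A B T (\<lambda>(x, y). b x y) t = tensor_lift K A B T (\<lambda>(x, y). b' x y) t"
proof (rule tensor_hom_eq[OF _ _ _ _ _ t])
  have b': "bilinear_map K A B T b'" by (rule bilinear_map_cong[OF b eq])
  show "mod_hom K (tensor K A B) T (tensor_lift K A B T (\<lambda>(x, y). b x y))"
    "mod_hom K (tensor K A B) T (tensor_lift K A B T (\<lambda>(x, y). b' x y))"
    by (rule mod_hom_tensor_lift[OF b], rule mod_hom_tensor_lift[OF b'])
  show "tensor_lift K A B T (\<lambda>(x, y). b x y) (pure_tensor K A B x y) =
      tensor_lift K A B T (\<lambda>(x, y). b' x y) (pure_tensor K A B x y)"
    if "x \<in> carrier A" "y \<in> carrier B" for x y
    using that by (simp add: tensor_lift_pure_tensor[OF b] tensor_lift_pure_tensor[OF b'] eq)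
qed (use b in \<open>auto simp: bilinear_map_def\<close>)

text \<open>Both sides are linear in \<open>t\<close> and agree on pure tensors. This carries a
  linear map inside a Sweedler sum.\<close>

lemma hom_tensor_lift:
  assumes f: "mod_hom K T U f" and b: "bilinear_map K A B T b" and t: "t \<in> carrier (tensor K A B)"
  shows "f (tensor_lift K A B T (\<lambda>(x, y). b x y) t) = tensor_lift K A B U (\<lambda>(x, y). f (b x y)) t"
proof -
  note fb = bilinear_map_comp_left[OF f b]
  show ?thesis
  proof (rule tensor_hom_eq[OF mod_hom_compose[OF f mod_hom_tensor_lift[OF b]] mod_hom_tensor_lift[OF fb] _ _ _ t])
    show "f (tensor_lift K A B T (\<lambda>(x, y). b x y) (pure_tensor K A B x y)) =
        tensor_lift K A B U (\<lambda>(x, y). f (b x y)) (pure_tensor K A B x y)"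
      if "x \<in> carrier A" "y \<in> carrier B" for x y
      using that by (simp add: tensor_lift_pure_tensor[OF b] tensor_lift_pure_tensor[OF fb])
  qed (use b in \<open>auto simp: bilinear_map_def\<close>)
qed

lemma hom_tensor_lift_eq:
  assumes "mod_hom K T U f" "bilinear_map K A B T b" "t \<in> carrier (tensor K A B)"
    and "\<And>x y. x \<in> carrier A \<Longrightarrow> y \<in> carrier B \<Longrightarrow> f (b x y) = c x y"
  shows "f (tensor_lift K A B T (\<lambda>(x, y). b x y) t) = tensor_lift K A B U (\<lambda>(x, y). c x y) t"
  using hom_tensor_lift[OF assms(1-3)] tensor_lift_cong[OF bilinear_map_comp_left[OF assms(1,2)] assms(3,4)]
  by simp

text \<open>For fixed \<open>x\<close> and \<open>y\<close> both sides of additivity are linear in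
  \<open>t\<close>, so pure tensors suffice; there the lift evaluates to \<open>c\<close>, which is
  linear in the parameter. Homogeneity follows in the same way.\<close>

lemma mod_hom_tensor_lift_param:
  assumes mods: "module K X" "module K A" "module K B" "module K T"
    and t: "t \<in> carrier (tensor K A B)"
    and c: "\<And>x. x \<in> carrier X \<Longrightarrow> bilinear_map K A B T (c x)"
    and l: "\<And>a b. a \<in> carrier A \<Longrightarrow> b \<in> carrier B \<Longrightarrow> mod_hom K X T (\<lambda>x. c x a b)"
  shows "mod_hom K X T (\<lambda>x. tensor_lift K A B T (\<lambda>(a, b). c x a b) t)"
proof -
  interpret X: module K X by fact
  interpret T: module K T by fact
  note hom = mod_hom_tensor_lift[OF c] and pure = tensor_lift_pure_tensor[OF c]
  have "tensor_lift K A B T (\<lambda>(a, b). c (x \<oplus>\<^bsub>X\<^esub> y) a b) t =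
      tensor_lift K A B T (\<lambda>(a, b). c x a b) t \<oplus>\<^bsub>T\<^esub> tensor_lift K A B T (\<lambda>(a, b). c y a b) t"
    if "x \<in> carrier X" "y \<in> carrier X" for x y
    using that mods
    by (intro tensor_hom_eq[OF hom mod_hom_plus[OF hom hom] _ _ _ t])
       (simp_all add: pure mod_hom_add[OF l])
  moreover have "tensor_lift K A B T (\<lambda>(a, b). c (r \<odot>\<^bsub>X\<^esub> x) a b) t =
      r \<odot>\<^bsub>T\<^esub> tensor_lift K A B T (\<lambda>(a, b). c x a b) t"
    if "r \<in> carrier K" "x \<in> carrier X" for r x
    using that mods
    by (intro tensor_hom_eq[OF hom mod_hom_scale[OF hom] _ _ _ t])
       (simp_all add: pure mod_hom_smult[OF l])
  ultimately show ?thesis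
    using mods mod_hom_closed[OF hom t] by (simp add: mod_hom_iff module_hom_def)
qed

text \<open>A Fubini rule for independent Sweedler sums. Both sides are linear in \<open>t\<close>,
  and for pure \<open>t\<close> the sum over its components collapses to one term, after which the
  two sides coincide.\<close>

lemma tensor_lift_commute:
  assumes s: "s \<in> carrier (tensor K A B)" and t: "t \<in> carrier (tensor K C D)"
    and T: "module K A" "module K B" "module K C" "module K D" "module K T"
    and b: "\<And>x y. x \<in> carrier C \<Longrightarrow> y \<in> carrier D \<Longrightarrow> bilinear_map K A B T (\<lambda>a b. c a b x y)"
    and d: "\<And>x y. x \<in> carrier A \<Longrightarrow> y \<in> carrier B \<Longrightarrow> bilinear_map K C D T (c x y)"
  shows "tensor_lift K A B T (\<lambda>(a, b). tensor_lift K C D T (\<lambda>(x, y). c a b x y) t) s =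
    tensor_lift K C D T (\<lambda>(x, y). tensor_lift K A B T (\<lambda>(a, b). c a b x y) s) t"
proof -
  \<comment> \<open>Stated for every \<open>t\<close>, since the argument below lets
    \<open>t\<close> vary while \<open>s\<close> stays fixed.\<close>
  have l: "bilinear_map K A B T (\<lambda>a b. tensor_lift K C D T (\<lambda>(x, y). c a b x y) t)"
    if "t \<in> carrier (tensor K C D)" for t
    using T b d that
    by (intro bilinear_mapI mod_hom_tensor_lift_param) (auto simp: bilinear_map_def)
  have r: "bilinear_map K C D T (\<lambda>x y. tensor_lift K A B T (\<lambda>(a, b). c a b x y) s)"
    using T b d s
    by (intro bilinear_mapI mod_hom_tensor_lift_param) (auto simp: bilinear_map_def)
  show ?thesis
  proof (rule tensor_hom_eq[OF _ mod_hom_tensor_lift[OF r] _ _ _ t])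
    show "mod_hom K (tensor K C D) T
        (\<lambda>t. tensor_lift K A B T (\<lambda>(a, b). tensor_lift K C D T (\<lambda>(x, y). c a b x y) t) s)"
      using T s mod_hom_tensor_lift[OF d]
      by (intro mod_hom_tensor_lift_param l) (auto simp: module_tensor)
    fix x y assume xy: "x \<in> carrier C" "y \<in> carrier D"
    have "tensor_lift K A B T (\<lambda>(a, b). tensor_lift K C D T (\<lambda>(x, y). c a b x y) (pure_tensor K C D x y)) s =
        tensor_lift K A B T (\<lambda>(a, b). c a b x y) s"
      using T s xy by (intro tensor_lift_cong l pure_tensor_closed) (simp_all add: tensor_lift_pure_tensor[OF d])
    then show "tensor_lift K A B T (\<lambda>(a, b). tensor_lift K C D T (\<lambda>(x, y). c a b x y) (pure_tensor K C D x y)) s =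
        tensor_lift K C D T (\<lambda>(x, y). tensor_lift K A B T (\<lambda>(a, b). c a b x y) s) (pure_tensor K C D x y)"
      using xy by (simp add: tensor_lift_pure_tensor[OF r])
  qed (use T in auto)
qed

text \<open>The third claim is the substitution rule for Sweedler sums. Through it, axioms phrased
  with \<open>tensor_map\<close>, such as colinearity of the structure maps, become rewriting rules
  for summands.\<close>

lemma
  assumes f: "mod_hom K A C f" and g: "mod_hom K B D g"
  shows mod_hom_tensor_map: "mod_hom K (tensor K A B) (tensor K C D) (tensor_map K A B C D f g)"
    and tensor_map_pure: "\<And>x y. x \<in> carrier A \<Longrightarrow> y \<in> carrier B \<Longrightarrow>
      tensor_map K A B C D f g (pure_tensor K A B x y) = pure_tensor K C D (f x) (g y)"
    and tensor_lift_tensor_map: "\<And>T b t. bilinear_map K C D T b \<Longrightarrow> t \<in> carrier (tensor K A B) \<Longrightarrow>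
      tensor_lift K C D T (\<lambda>(x, y). b x y) (tensor_map K A B C D f g t) =
      tensor_lift K A B T (\<lambda>(x, y). b (f x) (g y)) t"
proof -
  have mods: "module K A" "module K B" "module K C" "module K D"
    using f g by (auto simp: mod_hom_iff)
  note fg = bilinear_map_comp_right[OF bilinear_pure_tensor f g, OF mods(3,4)]
  show hom: "mod_hom K (tensor K A B) (tensor K C D) (tensor_map K A B C D f g)"
    unfolding tensor_map_def by (rule mod_hom_tensor_lift[OF fg])
  show pure: "tensor_map K A B C D f g (pure_tensor K A B x y) = pure_tensor K C D (f x) (g y)"
    if "x \<in> carrier A" "y \<in> carrier B" for x y
    unfolding tensor_map_def by (rule tensor_lift_pure_tensor[OF fg that])
  fix T b t assume b: "bilinear_map K C D T b" and t: "t \<in> carrier (tensor K A B)"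
  note bfg = bilinear_map_comp_right[OF b f g]
  show "tensor_lift K C D T (\<lambda>(x, y). b x y) (tensor_map K A B C D f g t) =
      tensor_lift K A B T (\<lambda>(x, y). b (f x) (g y)) t"
    using t
    by (rule tensor_hom_eq[OF mod_hom_compose[OF mod_hom_tensor_lift[OF b] hom] mod_hom_tensor_lift[OF bfg] mods(1,2), rotated])
       (use f g in \<open>simp add: pure tensor_lift_pure_tensor[OF b] tensor_lift_pure_tensor[OF bfg] mod_hom_closed\<close>)
qed

section \<open>Syntax-directed rules for linearity\<close>

lemma mod_hom_pure_tensor_left:
  assumes "mod_hom K X A f" "module K B" "y \<in> carrier B"
  shows "mod_hom K X (tensor K A B) (\<lambda>x. pure_tensor K A B (f x) y)"
proof (rule mod_hom_compose[where g = "\<lambda>x. pure_tensor K A B x y"])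
  show "mod_hom K A (tensor K A B) (\<lambda>x. pure_tensor K A B x y)"
    using bilinear_pure_tensor[of K A B] assms by (simp add: bilinear_map_def mod_hom_iff[of K X])
qed fact

lemma mod_hom_pure_tensor_right:
  assumes "module K A" "x \<in> carrier A" "mod_hom K X B f"
  shows "mod_hom K X (tensor K A B) (\<lambda>y. pure_tensor K A B x (f y))"
proof (rule mod_hom_compose[where g = "\<lambda>y. pure_tensor K A B x y"])
  show "mod_hom K B (tensor K A B) (\<lambda>y. pure_tensor K A B x y)"
    using bilinear_pure_tensor[of K A B] assms by (simp add: bilinear_map_def mod_hom_iff[of K X])
qed fact

text \<open>Here the variable sits in the tensor being expanded, while
  \<open>mod_hom_tensor_lift_param\<close> treats a variable in the summand; these are the two
  places where it can occur in a nested sum.\<close>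

lemma mod_hom_tensor_lift_comp:
  "bilinear_map K A B T b \<Longrightarrow> mod_hom K X (tensor K A B) f \<Longrightarrow>
    mod_hom K X T (\<lambda>x. tensor_lift K A B T (\<lambda>(x, y). b x y) (f x))"
  by (rule mod_hom_compose[OF mod_hom_tensor_lift])

lemma tensor_lift_closed:
  "bilinear_map K A B T b \<Longrightarrow> t \<in> carrier (tensor K A B) \<Longrightarrow>
    tensor_lift K A B T (\<lambda>(x, y). b x y) t \<in> carrier T"
  by (rule mod_hom_closed[OF mod_hom_tensor_lift])

text \<open>Used backwards by \<open>intro\<close>, these rules follow the syntax of an expression
  in which each variable occurs linearly, and so discharge most linearity and closure conditions
  below.\<close>

lemmas linear_intros = mod_hom_ident mod_hom_pure_tensor_left mod_hom_pure_tensor_right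
  mod_hom_tensor_lift_comp mod_hom_tensor_lift_param bilinear_mapI module_tensor
  pure_tensor_closed tensor_lift_closed

section \<open>Reassociation of threefold tensor products\<close>

context
  fixes K :: "('k, 'r) ring_scheme" and A :: "('k, 'a, 'u) module_scheme"
    and B :: "('k, 'b, 'v) module_scheme" and C :: "('k, 'c, 'w) module_scheme"
  assumes mods: "module K A" "module K B" "module K C"
begin

private lemma
  assumes c: "c \<in> carrier C"
  shows assoc_inner_bilinear: "bilinear_map K A B (tensor K A (tensor K B C))
    (\<lambda>a b. pure_tensor K A (tensor K B C) a (pure_tensor K B C b c))"
  using mods c by (intro linear_intros)

private lemma assoc_bilinear:
  "bilinear_map K (tensor K A B) C (tensor K A (tensor K B C)) (\<lambda>t c.
     tensor_lift K A B (tensor K A (tensor K B C)) (\<lambda>(a, b).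
       pure_tensor K A (tensor K B C) a (pure_tensor K B C b c)) t)"
  using mods by (intro linear_intros)

lemma mod_hom_tensor_assoc:
  "mod_hom K (tensor K (tensor K A B) C) (tensor K A (tensor K B C)) (tensor_assoc K A B C)"
  unfolding tensor_assoc_def Let_def by (rule mod_hom_tensor_lift[OF assoc_bilinear])

text \<open>The left factor may be a general tensor. Hom-coassociativity needs this form, since
  there the left factor is a value of \<open>\<Delta>\<close>.\<close>

lemma tensor_assoc_pure_right:
  assumes "t \<in> carrier (tensor K A B)" "c \<in> carrier C"
  shows "tensor_assoc K A B C (pure_tensor K (tensor K A B) C t c) =
    tensor_lift K A B (tensor K A (tensor K B C)) (\<lambda>(a, b).
       pure_tensor K A (tensor K B C) a (pure_tensor K B C b c)) t"
  unfolding tensor_assoc_def Let_def using assms by (rule tensor_lift_pure_tensor[OF assoc_bilinear])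

lemma tensor_assoc_pure:
  assumes "a \<in> carrier A" "b \<in> carrier B" "c \<in> carrier C"
  shows "tensor_assoc K A B C (pure_tensor K (tensor K A B) C (pure_tensor K A B a b) c) =
    pure_tensor K A (tensor K B C) a (pure_tensor K B C b c)"
  using assms mods
  by (simp add: tensor_assoc_pure_right pure_tensor_closed tensor_lift_pure_tensor[OF assoc_inner_bilinear])

private lemma unassoc_bilinear:
  "bilinear_map K A (tensor K B C) (tensor K (tensor K A B) C) (\<lambda>a t.
     tensor_lift K B C (tensor K (tensor K A B) C) (\<lambda>(b, c).
       pure_tensor K (tensor K A B) C (pure_tensor K A B a b) c) t)"
  using mods by (intro linear_intros)

private lemma unassoc_inner_bilinear:
  "a \<in> carrier A \<Longrightarrow> bilinear_map K B C (tensor K (tensor K A B) C)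
    (\<lambda>b c. pure_tensor K (tensor K A B) C (pure_tensor K A B a b) c)"
  using mods by (intro linear_intros)

lemma mod_hom_tensor_unassoc:
  "mod_hom K (tensor K A (tensor K B C)) (tensor K (tensor K A B) C) (tensor_unassoc K A B C)"
  unfolding tensor_unassoc_def Let_def by (rule mod_hom_tensor_lift[OF unassoc_bilinear])

lemma tensor_unassoc_pure:
  assumes "a \<in> carrier A" "b \<in> carrier B" "c \<in> carrier C"
  shows "tensor_unassoc K A B C (pure_tensor K A (tensor K B C) a (pure_tensor K B C b c)) =
    pure_tensor K (tensor K A B) C (pure_tensor K A B a b) c"
  unfolding tensor_unassoc_def Let_def using assms mods
  by (simp add: tensor_lift_pure_tensor[OF unassoc_bilinear] pure_tensor_closed
      tensor_lift_pure_tensor[OF unassoc_inner_bilinear])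

end

section \<open>Hom-comodules, Yetter--Drinfeld modules and their braiding\<close>

context hom_bialgebra
begin

lemma module_H: "module K H"
  by (rule module_axioms)

lemma mod_hom_mu: "mod_hom K (tensor K H H) H \<mu>"
  by (simp add: mod_hom_iff module_H module_tensor mu_linear)

lemma mod_hom_Delta: "mod_hom K H (tensor K H H) \<Delta>"
  by (simp add: mod_hom_iff module_H module_tensor Delta_linear)

lemma mod_hom_alpha: "mod_hom K H H \<alpha>"
  by (simp add: mod_hom_iff module_H alpha_linear)

text \<open>Composed with an arbitrary inner map, each \<open>mod_hom_compose\<close> rule peels one
  outer structure map off an expression. The collections for modules and comodules have the same
  shape.\<close>

lemmas linear_H = module_H
  mod_hom_compose[OF mod_hom_mu] mod_hom_compose[OF mod_hom_Delta] mod_hom_compose[OF mod_hom_alpha]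
  mod_hom_closed[OF mod_hom_mu] mod_hom_closed[OF mod_hom_Delta] mod_hom_closed[OF mod_hom_alpha]

end

section \<open>Hom-bialgebras with bijective structure map\<close>

locale bijective_hom_bialgebra = hom_bialgebra +
  assumes alpha_bij: "bij_betw \<alpha> (carrier H) (carrier H)"
begin

abbreviation alpha_inv (\<open>\<alpha>i\<close>) where "\<alpha>i \<equiv> inv_into (carrier H) \<alpha>"

lemma mod_hom_alpha_inv: "mod_hom K H H \<alpha>i"
  by (rule mod_hom_inv_into[OF mod_hom_alpha alpha_bij])

lemma alpha_inv_alpha [simp]: "h \<in> carrier H \<Longrightarrow> \<alpha>i (\<alpha> h) = h"
  by (rule bij_betw_inv_into_left[OF alpha_bij])

lemma alpha_alpha_inv [simp]: "h \<in> carrier H \<Longrightarrow> \<alpha> (\<alpha>i h) = h"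
  by (rule bij_betw_inv_into_right[OF alpha_bij])

lemmas linear_alpha_inv = mod_hom_compose[OF mod_hom_alpha_inv] mod_hom_closed[OF mod_hom_alpha_inv]

lemma alpha_inv_mult:
  assumes "g \<in> carrier H" "h \<in> carrier H"
  shows "\<alpha>i (g \<star> h) = \<alpha>i g \<star> \<alpha>i h"
proof -
  have "\<alpha>i g \<star> \<alpha>i h \<in> carrier H" using assms by (intro linear_intros linear_H linear_alpha_inv)
  then have "\<alpha>i (\<alpha> (\<alpha>i g \<star> \<alpha>i h)) = \<alpha>i g \<star> \<alpha>i h" by simp
  moreover have "\<alpha> (\<alpha>i g \<star> \<alpha>i h) = g \<star> h"
    using assms mod_hom_closed[OF mod_hom_alpha_inv] by (simp add: alpha_mult)
  ultimately show ?thesis by simp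
qed

text \<open>Since \<open>\<Delta>\<close> commutes with \<open>\<alpha>\<close>, it commutes with
  the inverse. One writes \<open>h\<close> as \<open>\<alpha> (\<alpha>i h)\<close>, expands with
  \<open>Delta_alpha\<close>, and cancels componentwise.\<close>

lemma tensor_lift_Delta_alpha_inv:
  assumes b: "bilinear_map K H H T b" and h: "h \<in> carrier H"
  shows "tensor_lift K H H T (\<lambda>(h1, h2). b (\<alpha>i h1) (\<alpha>i h2)) (\<Delta> h) =
    tensor_lift K H H T (\<lambda>(h1, h2). b h1 h2) (\<Delta> (\<alpha>i h))"
proof -
  note bi = bilinear_map_comp_right[OF b mod_hom_alpha_inv mod_hom_alpha_inv]
  have g: "\<alpha>i h \<in> carrier H" "\<Delta> (\<alpha>i h) \<in> carrier (tensor K H H)"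
    by (intro linear_intros linear_H linear_alpha_inv h)+
  have "tensor_lift K H H T (\<lambda>(h1, h2). b (\<alpha>i h1) (\<alpha>i h2)) (\<Delta> h) =
      tensor_lift K H H T (\<lambda>(h1, h2). b (\<alpha>i h1) (\<alpha>i h2)) (tensor_map K H H H H \<alpha> \<alpha> (\<Delta> (\<alpha>i h)))"
    using Delta_alpha[OF g(1)] h by simp
  also have "\<dots> = tensor_lift K H H T (\<lambda>(h1, h2). b (\<alpha>i (\<alpha> h1)) (\<alpha>i (\<alpha> h2))) (\<Delta> (\<alpha>i h))"
    by (rule tensor_lift_tensor_map[OF mod_hom_alpha mod_hom_alpha bi g(2)])
  also have "\<dots> = tensor_lift K H H T (\<lambda>(h1, h2). b h1 h2) (\<Delta> (\<alpha>i h))"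
    by (rule tensor_lift_cong[OF _ g(2), symmetric]) (simp_all add: b)
  finally show ?thesis .
qed

end

section \<open>Linearity of actions and coactions\<close>

context hom_module
begin

lemma module_M: "module K M"
  by (rule M.module_axioms)

lemma mod_hom_alphaM: "mod_hom K M M \<alpha>\<^sub>M"
  by (simp add: mod_hom_iff module_M alphaM_linear)

lemma mod_hom_act: "mod_hom K (tensor K H M) M act"
  by (simp add: mod_hom_iff module_M module_tensor module_axioms act_linear)

lemmas linear_module = module_M
  mod_hom_compose[OF mod_hom_alphaM] mod_hom_compose[OF mod_hom_act]
  mod_hom_closed[OF mod_hom_alphaM] mod_hom_closed[OF mod_hom_act]

end

context hom_comodule
begin

lemma module_M: "module K M"
  by (rule M.module_axioms)

lemma mod_hom_alphaM: "mod_hom K M M \<alpha>\<^sub>M"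
  by (simp add: mod_hom_iff module_M alphaM_linear)

lemma mod_hom_coact: "mod_hom K M (tensor K H M) coact"
  by (simp add: mod_hom_iff module_M module_tensor module_axioms coact_linear)

lemmas linear_comodule = module_M
  mod_hom_compose[OF mod_hom_alphaM] mod_hom_compose[OF mod_hom_coact]
  mod_hom_closed[OF mod_hom_alphaM] mod_hom_closed[OF mod_hom_coact]

end

text \<open>The two sides are the images of the two sides of \<open>coact_coact\<close> under one
  linear map on the threefold tensor product. The hypotheses on \<open>E\<close> together say that
  it is trilinear, so that this map exists.\<close>

lemma (in hom_comodule) tensor_lift_coact_coact:
  assumes m: "m \<in> carrier M" and T: "module K T"
    and E: "\<And>h. h \<in> carrier H \<Longrightarrow> bilinear_map K H M T (E h)"
    and E': "\<And>h x. h \<in> carrier H \<Longrightarrow> x \<in> carrier M \<Longrightarrow> mod_hom K H T (\<lambda>g. E g h x)"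
  shows "tensor_lift K H M T (\<lambda>(a, x). tensor_lift K H M T (\<lambda>(b, y). E (\<alpha> a) b y) (coact x)) (coact m) =
    tensor_lift K H M T (\<lambda>(a, x). tensor_lift K H H T (\<lambda>(h1, h2). E h1 h2 (\<alpha>\<^sub>M x)) (\<Delta> a)) (coact m)"
proof -
  have mods: "module K H" "module K M" by (rule module_H, rule module_M)
  let ?U = "tensor K H (tensor K H M)"
  \<comment> \<open>The linear map induced by \<open>E\<close>, built in two stages because the
    second tensor factor is itself a tensor product.\<close>
  define \<Phi> where "\<Phi> = tensor_lift K H (tensor K H M) T (\<lambda>(a, s). tensor_lift K H M T (\<lambda>(b, y). E a b y) s)"
  have bil: "bilinear_map K H (tensor K H M) T (\<lambda>a s. tensor_lift K H M T (\<lambda>(b, y). E a b y) s)"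
    by (intro linear_intros mods T E E')
  have \<Phi>: "mod_hom K ?U T \<Phi>"
    unfolding \<Phi>_def by (rule mod_hom_tensor_lift[OF bil])
  have \<Phi>_pure: "\<Phi> (pure_tensor K H (tensor K H M) a s) = tensor_lift K H M T (\<lambda>(b, y). E a b y) s"
    if "a \<in> carrier H" "s \<in> carrier (tensor K H M)" for a s
    unfolding \<Phi>_def by (rule tensor_lift_pure_tensor[OF bil that])
  have \<Phi>_pure2: "\<Phi> (pure_tensor K H (tensor K H M) a (pure_tensor K H M b y)) = E a b y"
    if "a \<in> carrier H" "b \<in> carrier H" "y \<in> carrier M" for a b y
    using that mods by (simp add: \<Phi>_pure pure_tensor_closed tensor_lift_pure_tensor[OF E])
  have t: "coact m \<in> carrier (tensor K H M)"
    by (rule mod_hom_closed[OF mod_hom_coact m])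
  have "\<Phi> (tensor_map K H M H (tensor K H M) \<alpha> coact (coact m)) =
      tensor_lift K H M T (\<lambda>(a, x). tensor_lift K H M T (\<lambda>(b, y). E (\<alpha> a) b y) (coact x)) (coact m)"
    unfolding \<Phi>_def by (rule tensor_lift_tensor_map[OF mod_hom_alpha mod_hom_coact bil t])
  moreover have "\<Phi> (tensor_assoc K H H M (tensor_map K H M (tensor K H H) M \<Delta> \<alpha>\<^sub>M (coact m))) =
      tensor_lift K H M T (\<lambda>(a, x). tensor_lift K H H T (\<lambda>(h1, h2). E h1 h2 (\<alpha>\<^sub>M x)) (\<Delta> a)) (coact m)"
    unfolding tensor_map_def
  proof (rule hom_tensor_lift_eq[where f = "\<lambda>t. \<Phi> (tensor_assoc K H H M t)", OF _ _ t])
    show "mod_hom K (tensor K (tensor K H H) M) T (\<lambda>t. \<Phi> (tensor_assoc K H H M t))"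
      by (rule mod_hom_compose[OF \<Phi> mod_hom_tensor_assoc[OF mods(1,1,2)]])
    show "bilinear_map K H M (tensor K (tensor K H H) M) (\<lambda>a x. pure_tensor K (tensor K H H) M (\<Delta> a) (\<alpha>\<^sub>M x))"
      by (rule bilinear_map_comp_right[OF bilinear_pure_tensor mod_hom_Delta mod_hom_alphaM]) (intro mods module_tensor)+
    fix a x assume ax: "a \<in> carrier H" "x \<in> carrier M"
    have cl: "\<Delta> a \<in> carrier (tensor K H H)" "\<alpha>\<^sub>M x \<in> carrier M"
      by (rule mod_hom_closed[OF mod_hom_Delta ax(1)], rule mod_hom_closed[OF mod_hom_alphaM ax(2)])
    show "\<Phi> (tensor_assoc K H H M (pure_tensor K (tensor K H H) M (\<Delta> a) (\<alpha>\<^sub>M x))) =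
        tensor_lift K H H T (\<lambda>(h1, h2). E h1 h2 (\<alpha>\<^sub>M x)) (\<Delta> a)"
      \<comment> \<open>The left factor \<open>\<Delta> a\<close> need not be pure, so reassociation
        leaves a sum over its components, through which \<open>\<Phi>\<close> must pass once
        more.\<close>
      unfolding tensor_assoc_pure_right[OF mods(1,1,2) cl]
    proof (rule hom_tensor_lift_eq[OF \<Phi> _ cl(1)])
      show "bilinear_map K H H ?U (\<lambda>h1 h2. pure_tensor K H (tensor K H M) h1 (pure_tensor K H M h2 (\<alpha>\<^sub>M x)))"
        by (intro linear_intros mods cl)
    qed (simp add: \<Phi>_pure2 cl)
  qed
  ultimately show ?thesis by (simp add: coact_coact[OF m])
qed

text \<open>The linear map induced by \<open>F\<close> is applied to both sides of the axiom and
  carried through the two nested sums. The compatibility condition can then be used under any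
  bilinear expression.\<close>

lemma (in yetter_drinfeld_module) tensor_lift_yetter_drinfeld:
  assumes h: "h \<in> carrier H" and m: "m \<in> carrier M" and F: "bilinear_map K H M T F"
  shows "tensor_lift K H H T (\<lambda>(h1, h2).
      tensor_lift K H M T (\<lambda>(a, x). F (a \<star> \<alpha> (\<alpha> h2)) x) (coact (h1 \<rhd> m))) (\<Delta> h) =
    tensor_lift K H H T (\<lambda>(h1, h2).
      tensor_lift K H M T (\<lambda>(a, x). F (\<alpha> (\<alpha> h1) \<star> \<alpha> a) (\<alpha> h2 \<rhd> x)) (coact m)) (\<Delta> h)"
proof -
  note lin = linear_H linear_module comodule.linear_comodule linear_intros
  note Fl = tensor_lift_pure_tensor[OF F]
  have t: "\<Delta> h \<in> carrier (tensor K H H)" "coact m \<in> carrier (tensor K H M)"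
    by (intro lin h m)+
  let ?f = "tensor_lift K H M T (\<lambda>(a, x). F a x)"
  have f: "mod_hom K (tensor K H M) T ?f" by (rule mod_hom_tensor_lift[OF F])
  have "?f (tensor_lift K H H (tensor K H M) (\<lambda>(h1, h2).
        tensor_lift K H M (tensor K H M) (\<lambda>(a, x).
          pure_tensor K H M (a \<star> \<alpha> (\<alpha> h2)) x) (coact (h1 \<rhd> m))) (\<Delta> h)) =
      tensor_lift K H H T (\<lambda>(h1, h2).
        tensor_lift K H M T (\<lambda>(a, x). F (a \<star> \<alpha> (\<alpha> h2)) x) (coact (h1 \<rhd> m))) (\<Delta> h)"
    by (intro hom_tensor_lift_eq[OF f _ t(1)] hom_tensor_lift_eq[OF f] Fl lin h m)
  moreover have "?f (tensor_lift K H H (tensor K H M) (\<lambda>(h1, h2).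
        tensor_lift K H M (tensor K H M) (\<lambda>(a, x).
          pure_tensor K H M (\<alpha> (\<alpha> h1) \<star> \<alpha> a) (\<alpha> h2 \<rhd> x)) (coact m)) (\<Delta> h)) =
      tensor_lift K H H T (\<lambda>(h1, h2).
        tensor_lift K H M T (\<lambda>(a, x). F (\<alpha> (\<alpha> h1) \<star> \<alpha> a) (\<alpha> h2 \<rhd> x)) (coact m)) (\<Delta> h)"
    by (intro hom_tensor_lift_eq[OF f _ t(1)] hom_tensor_lift_eq[OF f _ t(2)] Fl lin h m)
  ultimately show ?thesis by (simp add: yetter_drinfeld[OF h m])
qed

section \<open>The braiding and its compatibility with the structure maps\<close>

locale braiding_data = bijective_hom_bialgebra K H \<mu> \<Delta> \<alpha> +
  M: hom_comodule K H \<mu> \<Delta> \<alpha> M \<alpha>\<^sub>M coactM + N: hom_module K H \<mu> \<Delta> \<alpha> N \<alpha>\<^sub>N actN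
  for K :: "('k, 'r) ring_scheme" and H :: "('k, 'h, 'a) module_scheme" and \<mu> \<Delta> \<alpha>
    and M :: "('k, 'm, 'b) module_scheme" and \<alpha>\<^sub>M coactM
    and N :: "('k, 'n, 'c) module_scheme" and \<alpha>\<^sub>N actN
begin

abbreviation "B \<equiv> yd_braiding K H \<alpha> M coactM N actN"

lemmas linear_MN = linear_intros linear_H linear_alpha_inv M.linear_comodule N.linear_module

lemma braiding_bilinear:
  "bilinear_map K M N (tensor K N M) (\<lambda>m n. tensor_lift K H M (tensor K N M)
    (\<lambda>(a, x). pure_tensor K N M (N.action (\<alpha>i a) n) x) (coactM m))"
  by (intro linear_MN)

lemma mod_hom_braiding: "mod_hom K (tensor K M N) (tensor K N M) B"
  unfolding yd_braiding_def by (rule mod_hom_tensor_lift[OF braiding_bilinear])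

text \<open>On a pure tensor the braiding is a single Sweedler sum, and \<open>f\<close>, typically
  the rest of a composite, passes inside it. The summand \<open>c\<close> is then computed by the
  caller.\<close>

lemma hom_braiding:
  assumes f: "mod_hom K (tensor K N M) T f" and m: "m \<in> carrier M" and n: "n \<in> carrier N"
    and eq: "\<And>a x. a \<in> carrier H \<Longrightarrow> x \<in> carrier M \<Longrightarrow>
      f (pure_tensor K N M (N.action (\<alpha>i a) n) x) = c a x"
  shows "f (B (pure_tensor K M N m n)) = tensor_lift K H M T (\<lambda>(a, x). c a x) (coactM m)"
  unfolding yd_braiding_def tensor_lift_pure_tensor[OF braiding_bilinear m n]
  using n by (intro hom_tensor_lift_eq[OF f _ _ eq] linear_MN m)

text \<open>Colinearity of \<open>\<alpha>\<^sub>M\<close> turns the components of the coaction at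
  \<open>\<alpha>\<^sub>M m\<close> into \<open>\<alpha> a\<close> and
  \<open>\<alpha>\<^sub>M x\<close>; the inverse in the braiding cancels, and \<open>a\<close>
  itself acts.\<close>

lemma hom_braiding_alpha:
  assumes f: "mod_hom K (tensor K N M) T f" and m: "m \<in> carrier M" and n: "n \<in> carrier N"
    and eq: "\<And>a x. a \<in> carrier H \<Longrightarrow> x \<in> carrier M \<Longrightarrow>
      f (pure_tensor K N M (N.action a n) (\<alpha>\<^sub>M x)) = c a x"
  shows "f (B (pure_tensor K M N (\<alpha>\<^sub>M m) n)) = tensor_lift K H M T (\<lambda>(a, x). c a x) (coactM m)"
proof -
  have t: "coactM m \<in> carrier (tensor K H M)" by (intro linear_MN m)
  have bil: "bilinear_map K H M T (\<lambda>a x. f (pure_tensor K N M (N.action (\<alpha>i a) n) x))"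
    by (rule bilinear_map_comp_left[OF f]) (intro linear_MN n)
  have "f (B (pure_tensor K M N (\<alpha>\<^sub>M m) n)) =
      tensor_lift K H M T (\<lambda>(a, x). f (pure_tensor K N M (N.action (\<alpha>i a) n) x)) (coactM (\<alpha>\<^sub>M m))"
    by (rule hom_braiding[OF f _ n refl]) (intro linear_MN m)
  also have "\<dots> = tensor_lift K H M T (\<lambda>(a, x). f (pure_tensor K N M (N.action (\<alpha>i (\<alpha> a)) n) (\<alpha>\<^sub>M x))) (coactM m)"
    unfolding M.alpha_coact[OF m, symmetric]
    by (rule tensor_lift_tensor_map[OF mod_hom_alpha M.mod_hom_alphaM bil t])
  also have "\<dots> = tensor_lift K H M T (\<lambda>(a, x). c a x) (coactM m)"
    by (rule tensor_lift_cong[OF bilinear_map_comp_right[OF bil mod_hom_alpha M.mod_hom_alphaM] t]) (simp add: eq)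
  finally show ?thesis .
qed

text \<open>On pure tensors, \<open>\<alpha>\<^sub>N\<close> applied after the braiding turns the
  acting element \<open>\<alpha>i a\<close> into \<open>a\<close>. On the other side
  \<open>hom_braiding_alpha\<close> cancels the same inverse, and the two sums coincide.\<close>

lemma braiding_alpha:
  assumes t: "t \<in> carrier (tensor K M N)"
  shows "tensor_map K N M N M \<alpha>\<^sub>N \<alpha>\<^sub>M (B t) = B (tensor_map K M N M N \<alpha>\<^sub>M \<alpha>\<^sub>N t)"
proof (rule tensor_hom_eq[OF _ _ M.module_M N.module_M _ t])
  note maps = mod_hom_tensor_map[OF N.mod_hom_alphaM M.mod_hom_alphaM]
    mod_hom_tensor_map[OF M.mod_hom_alphaM N.mod_hom_alphaM]
  show "mod_hom K (tensor K M N) (tensor K N M) (\<lambda>t. tensor_map K N M N M \<alpha>\<^sub>N \<alpha>\<^sub>M (B t))"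
    "mod_hom K (tensor K M N) (tensor K N M) (\<lambda>t. B (tensor_map K M N M N \<alpha>\<^sub>M \<alpha>\<^sub>N t))"
    using mod_hom_compose[OF maps(1) mod_hom_braiding] mod_hom_compose[OF mod_hom_braiding maps(2)] .
  fix m n assume m: "m \<in> carrier M" and n: "n \<in> carrier N"
  let ?c = "\<lambda>a x. pure_tensor K N M (N.action a (\<alpha>\<^sub>N n)) (\<alpha>\<^sub>M x)"
  have "tensor_map K N M N M \<alpha>\<^sub>N \<alpha>\<^sub>M (B (pure_tensor K M N m n)) =
      tensor_lift K H M (tensor K N M) (\<lambda>(a, x). ?c a x) (coactM m)"
  proof (rule hom_braiding[OF maps(1) m n])
    fix a x assume ax: "a \<in> carrier H" "x \<in> carrier M"
    have a: "\<alpha>i a \<in> carrier H" "N.action (\<alpha>i a) n \<in> carrier N" by (intro linear_MN ax n)+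
    show "tensor_map K N M N M \<alpha>\<^sub>N \<alpha>\<^sub>M (pure_tensor K N M (N.action (\<alpha>i a) n) x) = ?c a x"
      using ax a n by (simp add: tensor_map_pure[OF N.mod_hom_alphaM M.mod_hom_alphaM] N.alpha_act)
  qed
  also have "\<dots> = B (pure_tensor K M N (\<alpha>\<^sub>M m) (\<alpha>\<^sub>N n))"
  proof (rule hom_braiding_alpha[where f = "\<lambda>t. t", symmetric, OF _ m])
    show "mod_hom K (tensor K N M) (tensor K N M) (\<lambda>t. t)" "\<alpha>\<^sub>N n \<in> carrier N"
      by (intro linear_MN n)+
  qed simp
  finally show "tensor_map K N M N M \<alpha>\<^sub>N \<alpha>\<^sub>M (B (pure_tensor K M N m n)) =
      B (tensor_map K M N M N \<alpha>\<^sub>M \<alpha>\<^sub>N (pure_tensor K M N m n))"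
    using m n by (simp add: tensor_map_pure[OF M.mod_hom_alphaM N.mod_hom_alphaM])
qed

end

section \<open>The Hom-Yang--Baxter equation\<close>

locale yetter_drinfeld_triple = bijective_hom_bialgebra K H \<mu> \<Delta> \<alpha> +
  M: yetter_drinfeld_module K H \<mu> \<Delta> \<alpha> M \<alpha>\<^sub>M actM coactM +
  N: yetter_drinfeld_module K H \<mu> \<Delta> \<alpha> N \<alpha>\<^sub>N actN coactN +
  P: yetter_drinfeld_module K H \<mu> \<Delta> \<alpha> P \<alpha>\<^sub>P actP coactP
  for K :: "('k, 'r) ring_scheme" and H :: "('k, 'h, 'a) module_scheme" and \<mu> \<Delta> \<alpha>
    and M :: "('k, 'm, 'b) module_scheme" and \<alpha>\<^sub>M actM coactM
    and N :: "('k, 'n, 'c) module_scheme" and \<alpha>\<^sub>N actN coactN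
    and P :: "('k, 'p, 'd) module_scheme" and \<alpha>\<^sub>P actP coactP
begin

sublocale MN: braiding_data K H \<mu> \<Delta> \<alpha> M \<alpha>\<^sub>M coactM N \<alpha>\<^sub>N actN
  by unfold_locales
sublocale MP: braiding_data K H \<mu> \<Delta> \<alpha> M \<alpha>\<^sub>M coactM P \<alpha>\<^sub>P actP
  by unfold_locales
sublocale NP: braiding_data K H \<mu> \<Delta> \<alpha> N \<alpha>\<^sub>N coactN P \<alpha>\<^sub>P actP
  by unfold_locales

section \<open>The two composites of the equation: linearity and common value\<close>

abbreviation "PNM \<equiv> tensor K P (tensor K N M)"

lemmas mods = module_H M.module_M N.module_M P.module_M

lemmas linear_MNP = linear_intros linear_H linear_alpha_inv M.linear_module
  M.comodule.linear_comodule N.linear_module N.comodule.linear_comodule P.linear_module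

lemmas linear_maps = MN.mod_hom_braiding MP.mod_hom_braiding NP.mod_hom_braiding
  M.mod_hom_alphaM N.mod_hom_alphaM P.mod_hom_alphaM
  mod_hom_compose[OF mod_hom_tensor_map] mod_hom_compose[OF mod_hom_tensor_assoc]
  mod_hom_compose[OF mod_hom_tensor_unassoc]
  mod_hom_compose[OF MN.mod_hom_braiding] mod_hom_compose[OF MP.mod_hom_braiding]
  mod_hom_compose[OF NP.mod_hom_braiding]

text \<open>The explicit argument, in place of a chain of compositions, lets the rules in
  \<open>linear_maps\<close> peel off one map at a time. The same holds for
  \<open>yb_right\<close>.\<close>

definition yb_left where
  "yb_left t = tensor_map K P (tensor K M N) P (tensor K N M) \<alpha>\<^sub>P MN.B
    (tensor_assoc K P M N
    (tensor_map K (tensor K M P) N (tensor K P M) N MP.B \<alpha>\<^sub>N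
    (tensor_unassoc K M P N
    (tensor_map K M (tensor K N P) M (tensor K P N) \<alpha>\<^sub>M NP.B t))))"

definition yb_right where
  "yb_right t = tensor_assoc K P N M
    (tensor_map K (tensor K N P) M (tensor K P N) M NP.B \<alpha>\<^sub>M
    (tensor_unassoc K N P M
    (tensor_map K N (tensor K M P) N (tensor K P M) \<alpha>\<^sub>N MP.B
    (tensor_assoc K N M P
    (tensor_map K (tensor K M N) P (tensor K N M) P MN.B \<alpha>\<^sub>P
    (tensor_unassoc K M N P t))))))"

lemma mod_hom_yb:
  "mod_hom K (tensor K M (tensor K N P)) PNM yb_left"
  "mod_hom K (tensor K M (tensor K N P)) PNM yb_right"
  unfolding yb_left_def[abs_def] yb_right_def[abs_def]
  by (intro linear_maps mods linear_intros)+

text \<open>The order of the sums is part of the normal form: the coaction of \<open>m\<close>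
  outside, then \<open>\<Delta>\<close>, then the coaction of \<open>n\<close>. The right composite
  produces this order by itself; the left one has to be rearranged.\<close>

abbreviation yb_normal where
  "yb_normal m n p \<equiv> tensor_lift K H M PNM (\<lambda>(a, x).
     tensor_lift K H H PNM (\<lambda>(g1, g2).
       tensor_lift K H N PNM (\<lambda>(c, y).
         pure_tensor K P (tensor K N M) (P.action (g1 \<star> c) (\<alpha>\<^sub>P (\<alpha>\<^sub>P p)))
           (pure_tensor K N M (N.action (\<alpha> g2) (\<alpha>\<^sub>N y)) (\<alpha>\<^sub>M (\<alpha>\<^sub>M x))))
       (coactN n)) (\<Delta> (\<alpha>i a))) (coactM m)"

text \<open>The maps still to be applied after the first and second braidings are named
  \<open>\<psi>\<close> and \<open>\<phi>\<close>. Being linear, they pass inside the sum that each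
  braiding creates, so the composite is evaluated one braiding at a time.\<close>

lemma yb_left_pure:
  assumes m: "m \<in> carrier M" and n: "n \<in> carrier N" and p: "p \<in> carrier P"
  shows "yb_left (pure_tensor K M (tensor K N P) m (pure_tensor K N P n p)) = yb_normal m n p"
proof -
  define \<phi> where "\<phi> s = tensor_map K P (tensor K M N) P (tensor K N M) \<alpha>\<^sub>P MN.B (tensor_assoc K P M N s)" for s
  define \<psi> where "\<psi> s = \<phi> (tensor_map K (tensor K M P) N (tensor K P M) N MP.B \<alpha>\<^sub>N (tensor_unassoc K M P N s))" for s
  have \<phi>: "mod_hom K (tensor K (tensor K P M) N) PNM \<phi>"
    unfolding \<phi>_def[abs_def] by (intro linear_maps mods linear_intros)
  have \<psi>: "mod_hom K (tensor K M (tensor K P N)) PNM \<psi>"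
    unfolding \<psi>_def[abs_def] by (intro mod_hom_compose[OF \<phi>] linear_maps mods linear_intros)
  \<comment> \<open>The factor \<open>\<alpha>\<^sub>M x\<close> is what the preceding braiding
    leaves behind when it is applied to \<open>\<alpha>\<^sub>M m\<close>.\<close>
  have \<phi>_pure: "\<phi> (pure_tensor K (tensor K P M) N (pure_tensor K P M q (\<alpha>\<^sub>M x)) y) =
      tensor_lift K H M PNM (\<lambda>(b, z). pure_tensor K P (tensor K N M) (\<alpha>\<^sub>P q)
        (pure_tensor K N M (N.action b y) (\<alpha>\<^sub>M z))) (coactM x)"
    if "q \<in> carrier P" "x \<in> carrier M" "y \<in> carrier N" for q x y
  proof -
    have cl: "\<alpha>\<^sub>M x \<in> carrier M" "pure_tensor K M N (\<alpha>\<^sub>M x) y \<in> carrier (tensor K M N)" "\<alpha>\<^sub>P q \<in> carrier P"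
      by (intro linear_MNP that)+
    have "\<phi> (pure_tensor K (tensor K P M) N (pure_tensor K P M q (\<alpha>\<^sub>M x)) y) =
        pure_tensor K P (tensor K N M) (\<alpha>\<^sub>P q) (MN.B (pure_tensor K M N (\<alpha>\<^sub>M x) y))"
      unfolding \<phi>_def
      by (simp add: tensor_assoc_pure tensor_map_pure[OF P.mod_hom_alphaM MN.mod_hom_braiding] mods that cl)
    also have "\<dots> = tensor_lift K H M PNM (\<lambda>(b, z). pure_tensor K P (tensor K N M) (\<alpha>\<^sub>P q)
        (pure_tensor K N M (N.action b y) (\<alpha>\<^sub>M z))) (coactM x)"
      by (rule MN.hom_braiding_alpha[OF _ that(2,3) refl]) (intro linear_MNP cl)
    finally show ?thesis .
  qed
  have \<psi>_pure: "\<psi> (pure_tensor K M (tensor K P N) (\<alpha>\<^sub>M m) (pure_tensor K P N q y)) =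
      tensor_lift K H M PNM (\<lambda>(a, x). tensor_lift K H M PNM (\<lambda>(b, z).
        pure_tensor K P (tensor K N M) (\<alpha>\<^sub>P (P.action a q))
          (pure_tensor K N M (N.action b (\<alpha>\<^sub>N y)) (\<alpha>\<^sub>M z))) (coactM x)) (coactM m)"
    if "q \<in> carrier P" "y \<in> carrier N" for q y
  proof -
    have cl: "\<alpha>\<^sub>M m \<in> carrier M" "\<alpha>\<^sub>N y \<in> carrier N"
      "pure_tensor K M P (\<alpha>\<^sub>M m) q \<in> carrier (tensor K M P)"
      by (intro linear_MNP m that)+
    have "\<psi> (pure_tensor K M (tensor K P N) (\<alpha>\<^sub>M m) (pure_tensor K P N q y)) =
        \<phi> (pure_tensor K (tensor K P M) N (MP.B (pure_tensor K M P (\<alpha>\<^sub>M m) q)) (\<alpha>\<^sub>N y))"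
      unfolding \<psi>_def
      by (simp add: tensor_unassoc_pure tensor_map_pure[OF MP.mod_hom_braiding N.mod_hom_alphaM] mods that cl)
    also have "\<dots> = tensor_lift K H M PNM (\<lambda>(a, x). tensor_lift K H M PNM (\<lambda>(b, z).
        pure_tensor K P (tensor K N M) (\<alpha>\<^sub>P (P.action a q))
          (pure_tensor K N M (N.action b (\<alpha>\<^sub>N y)) (\<alpha>\<^sub>M z))) (coactM x)) (coactM m)"
    proof (rule MP.hom_braiding_alpha[where f = "\<lambda>s. \<phi> (pure_tensor K (tensor K P M) N s (\<alpha>\<^sub>N y))", OF _ m that(1)])
      show "mod_hom K (tensor K P M) PNM (\<lambda>s. \<phi> (pure_tensor K (tensor K P M) N s (\<alpha>\<^sub>N y)))"
        by (intro mod_hom_compose[OF \<phi>] linear_MNP that)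
    qed (intro \<phi>_pure linear_MNP that)
    finally show ?thesis .
  qed
  let ?E = "\<lambda>b y h1 h2 x. pure_tensor K P (tensor K N M) (P.action (\<alpha>i h1 \<star> b) (\<alpha>\<^sub>P (\<alpha>\<^sub>P p)))
    (pure_tensor K N M (N.action h2 (\<alpha>\<^sub>N y)) (\<alpha>\<^sub>M x))"
  have cl: "\<alpha>\<^sub>M m \<in> carrier M" "coactM m \<in> carrier (tensor K H M)" "coactN n \<in> carrier (tensor K H N)"
    "pure_tensor K N P n p \<in> carrier (tensor K N P)"
    by (intro linear_MNP m n p)+
  have \<psi>_normal: "\<psi> (pure_tensor K M (tensor K P N) (\<alpha>\<^sub>M m) (pure_tensor K P N (P.action (\<alpha>i b) p) y)) =
      tensor_lift K H M PNM (\<lambda>(a, x).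
        tensor_lift K H H PNM (\<lambda>(g1, g2).
          pure_tensor K P (tensor K N M) (P.action (g1 \<star> b) (\<alpha>\<^sub>P (\<alpha>\<^sub>P p)))
            (pure_tensor K N M (N.action (\<alpha> g2) (\<alpha>\<^sub>N y)) (\<alpha>\<^sub>M (\<alpha>\<^sub>M x)))) (\<Delta> (\<alpha>i a))) (coactM m)"
    if bc: "b \<in> carrier H" "y \<in> carrier N" for b y
  proof -
    have q: "P.action (\<alpha>i b) p \<in> carrier P" "\<alpha>\<^sub>P p \<in> carrier P" "\<alpha>i b \<in> carrier H" by (intro linear_MNP bc p)+
    \<comment> \<open>Applying \<open>\<alpha>\<^sub>P\<close> gives \<open>\<alpha> a\<close>
      acting on the result of \<open>b\<close> acting on \<open>\<alpha>\<^sub>P p\<close>, to which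
      \<open>act_act\<close> applies. The factor \<open>a\<close> is spelled
      \<open>\<alpha>i (\<alpha> a)\<close> to expose the argument \<open>\<alpha> a\<close>
      required by Hom-coassociativity.\<close>
    have act: "\<alpha>\<^sub>P (P.action a (P.action (\<alpha>i b) p)) = P.action (\<alpha>i (\<alpha> a) \<star> b) (\<alpha>\<^sub>P (\<alpha>\<^sub>P p))"
      if "a \<in> carrier H" for a
      using that q bc p by (simp add: P.alpha_act P.act_act)
    have "\<psi> (pure_tensor K M (tensor K P N) (\<alpha>\<^sub>M m) (pure_tensor K P N (P.action (\<alpha>i b) p) y)) =
        tensor_lift K H M PNM (\<lambda>(a, x). tensor_lift K H M PNM (\<lambda>(h2, z). ?E b y (\<alpha> a) h2 z) (coactM x)) (coactM m)"
      unfolding \<psi>_pure[OF q(1) bc(2)]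
    proof (rule tensor_lift_cong[OF _ cl(2)])
      show "bilinear_map K H M PNM (\<lambda>a x. tensor_lift K H M PNM (\<lambda>(h2, z).
          pure_tensor K P (tensor K N M) (\<alpha>\<^sub>P (P.action a (P.action (\<alpha>i b) p)))
            (pure_tensor K N M (N.action h2 (\<alpha>\<^sub>N y)) (\<alpha>\<^sub>M z))) (coactM x))"
        by (intro linear_MNP bc p)
    qed (simp add: act)
    also have "\<dots> = tensor_lift K H M PNM (\<lambda>(a, x). tensor_lift K H H PNM (\<lambda>(h1, h2). ?E b y h1 h2 (\<alpha>\<^sub>M x)) (\<Delta> a)) (coactM m)"
      by (rule M.comodule.tensor_lift_coact_coact[OF m]) (assumption | intro linear_MNP bc p)+
    also have "\<dots> = tensor_lift K H M PNM (\<lambda>(a, x). tensor_lift K H H PNM (\<lambda>(g1, g2).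
          pure_tensor K P (tensor K N M) (P.action (g1 \<star> b) (\<alpha>\<^sub>P (\<alpha>\<^sub>P p)))
            (pure_tensor K N M (N.action (\<alpha> g2) (\<alpha>\<^sub>N y)) (\<alpha>\<^sub>M (\<alpha>\<^sub>M x)))) (\<Delta> (\<alpha>i a))) (coactM m)"
    proof (rule tensor_lift_cong[OF _ cl(2)])
      show "bilinear_map K H M PNM (\<lambda>a x. tensor_lift K H H PNM (\<lambda>(h1, h2). ?E b y h1 h2 (\<alpha>\<^sub>M x)) (\<Delta> a))"
        by (intro linear_MNP bc p)
      fix a x assume ax: "a \<in> carrier H" "x \<in> carrier M"
      \<comment> \<open>With \<open>h2\<close> written as \<open>\<alpha> (\<alpha>i h2)\<close>,
        the summand depends on the components of \<open>\<Delta> a\<close> only through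
        \<open>\<alpha>i\<close>, and the sum moves to
        \<open>\<Delta> (\<alpha>i a)\<close>.\<close>
      let ?b = "\<lambda>g1 g2. pure_tensor K P (tensor K N M) (P.action (g1 \<star> b) (\<alpha>\<^sub>P (\<alpha>\<^sub>P p)))
            (pure_tensor K N M (N.action (\<alpha> g2) (\<alpha>\<^sub>N y)) (\<alpha>\<^sub>M (\<alpha>\<^sub>M x)))"
      have bil: "bilinear_map K H H PNM (\<lambda>h1 h2. ?b h1 h2)" "bilinear_map K H H PNM (\<lambda>h1 h2. ?b (\<alpha>i h1) (\<alpha>i h2))"
        by (assumption | intro linear_MNP bc p ax)+
      have "tensor_lift K H H PNM (\<lambda>(h1, h2). ?E b y h1 h2 (\<alpha>\<^sub>M x)) (\<Delta> a) =
          tensor_lift K H H PNM (\<lambda>(h1, h2). ?b (\<alpha>i h1) (\<alpha>i h2)) (\<Delta> a)"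
        by (rule tensor_lift_cong[OF bil(2), symmetric]) (simp_all add: mod_hom_closed[OF mod_hom_Delta ax(1)])
      then show "tensor_lift K H H PNM (\<lambda>(h1, h2). ?E b y h1 h2 (\<alpha>\<^sub>M x)) (\<Delta> a) =
          tensor_lift K H H PNM (\<lambda>(g1, g2). ?b g1 g2) (\<Delta> (\<alpha>i a))"
        using tensor_lift_Delta_alpha_inv[OF bil(1) ax(1)] by simp
    qed
    finally show ?thesis .
  qed
  have "yb_left (pure_tensor K M (tensor K N P) m (pure_tensor K N P n p)) =
      \<psi> (pure_tensor K M (tensor K P N) (\<alpha>\<^sub>M m) (NP.B (pure_tensor K N P n p)))"
    unfolding yb_left_def \<psi>_def \<phi>_def
    by (simp add: tensor_map_pure[OF M.mod_hom_alphaM NP.mod_hom_braiding] m cl)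
  also have "\<dots> = tensor_lift K H N PNM (\<lambda>(b, y). tensor_lift K H M PNM (\<lambda>(a, x).
        tensor_lift K H H PNM (\<lambda>(g1, g2).
          pure_tensor K P (tensor K N M) (P.action (g1 \<star> b) (\<alpha>\<^sub>P (\<alpha>\<^sub>P p)))
            (pure_tensor K N M (N.action (\<alpha> g2) (\<alpha>\<^sub>N y)) (\<alpha>\<^sub>M (\<alpha>\<^sub>M x)))) (\<Delta> (\<alpha>i a))) (coactM m)) (coactN n)"
    by (rule NP.hom_braiding[where f = "\<lambda>s. \<psi> (pure_tensor K M (tensor K P N) (\<alpha>\<^sub>M m) s)", OF _ n p \<psi>_normal])
       (intro mod_hom_compose[OF \<psi>] linear_MNP m)
  \<comment> \<open>The braiding of \<open>N\<close> with \<open>P\<close> acts first and leaves the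
    coaction of \<open>n\<close> outermost. It is moved inward past the coaction of \<open>m\<close>
    here and past \<open>\<Delta>\<close> in the next step.\<close>
  also have "\<dots> = tensor_lift K H M PNM (\<lambda>(a, x). tensor_lift K H N PNM (\<lambda>(b, y).
        tensor_lift K H H PNM (\<lambda>(g1, g2).
          pure_tensor K P (tensor K N M) (P.action (g1 \<star> b) (\<alpha>\<^sub>P (\<alpha>\<^sub>P p)))
            (pure_tensor K N M (N.action (\<alpha> g2) (\<alpha>\<^sub>N y)) (\<alpha>\<^sub>M (\<alpha>\<^sub>M x)))) (\<Delta> (\<alpha>i a))) (coactN n)) (coactM m)"
    by (rule tensor_lift_commute[OF cl(3,2)]) (assumption | intro linear_MNP p)+
  also have "\<dots> = yb_normal m n p"
  proof (rule tensor_lift_cong[OF _ cl(2)])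
    show "bilinear_map K H M PNM (\<lambda>a x. tensor_lift K H N PNM (\<lambda>(b, y).
        tensor_lift K H H PNM (\<lambda>(g1, g2).
          pure_tensor K P (tensor K N M) (P.action (g1 \<star> b) (\<alpha>\<^sub>P (\<alpha>\<^sub>P p)))
            (pure_tensor K N M (N.action (\<alpha> g2) (\<alpha>\<^sub>N y)) (\<alpha>\<^sub>M (\<alpha>\<^sub>M x)))) (\<Delta> (\<alpha>i a))) (coactN n))"
      by (intro linear_MNP n p)
    fix a x assume ax: "a \<in> carrier H" "x \<in> carrier M"
    have "\<Delta> (\<alpha>i a) \<in> carrier (tensor K H H)" by (intro linear_MNP ax)
    then show "tensor_lift K H N PNM (\<lambda>(b, y). tensor_lift K H H PNM (\<lambda>(g1, g2).
          pure_tensor K P (tensor K N M) (P.action (g1 \<star> b) (\<alpha>\<^sub>P (\<alpha>\<^sub>P p)))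
            (pure_tensor K N M (N.action (\<alpha> g2) (\<alpha>\<^sub>N y)) (\<alpha>\<^sub>M (\<alpha>\<^sub>M x)))) (\<Delta> (\<alpha>i a))) (coactN n) =
        tensor_lift K H H PNM (\<lambda>(g1, g2). tensor_lift K H N PNM (\<lambda>(b, y).
          pure_tensor K P (tensor K N M) (P.action (g1 \<star> b) (\<alpha>\<^sub>P (\<alpha>\<^sub>P p)))
            (pure_tensor K N M (N.action (\<alpha> g2) (\<alpha>\<^sub>N y)) (\<alpha>\<^sub>M (\<alpha>\<^sub>M x)))) (coactN n)) (\<Delta> (\<alpha>i a))"
      by (rule tensor_lift_commute[OF cl(3)]) (assumption | intro linear_MNP ax p)+
  qed
  finally show ?thesis .
qed

text \<open>The last braiding takes the coaction of an element of \<open>N\<close> on which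
  \<open>H\<close> has already acted. This is where the Yetter-Drinfeld condition intervenes, after
  Hom-coassociativity has merged the two coactions coming from \<open>m\<close>.\<close>

lemma yb_right_pure:
  assumes m: "m \<in> carrier M" and n: "n \<in> carrier N" and p: "p \<in> carrier P"
  shows "yb_right (pure_tensor K M (tensor K N P) m (pure_tensor K N P n p)) = yb_normal m n p"
proof -
  define \<phi> where "\<phi> s = tensor_assoc K P N M
    (tensor_map K (tensor K N P) M (tensor K P N) M NP.B \<alpha>\<^sub>M (tensor_unassoc K N P M s))" for s
  define \<psi> where "\<psi> s = \<phi> (tensor_map K N (tensor K M P) N (tensor K P M) \<alpha>\<^sub>N MP.B (tensor_assoc K N M P s))" for s
  have \<phi>: "mod_hom K (tensor K N (tensor K P M)) PNM \<phi>"
    unfolding \<phi>_def[abs_def] by (intro linear_maps mods linear_intros)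
  have \<psi>: "mod_hom K (tensor K (tensor K N M) P) PNM \<psi>"
    unfolding \<psi>_def[abs_def] by (intro mod_hom_compose[OF \<phi>] linear_maps mods linear_intros)
  have cl: "coactM m \<in> carrier (tensor K H M)" "coactN n \<in> carrier (tensor K H N)"
    "pure_tensor K M N m n \<in> carrier (tensor K M N)" "\<alpha>\<^sub>P p \<in> carrier P" "\<alpha>\<^sub>N n \<in> carrier N"
    by (intro linear_MNP m n p)+
  have \<phi>_pure: "\<phi> (pure_tensor K N (tensor K P M) y (pure_tensor K P M (P.action (\<alpha>i b) (\<alpha>\<^sub>P p)) x)) =
      tensor_lift K H N PNM (\<lambda>(c, z). pure_tensor K P (tensor K N M) (P.action (\<alpha>i (\<alpha>i c) \<star> \<alpha>i b) (\<alpha>\<^sub>P (\<alpha>\<^sub>P p)))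
        (pure_tensor K N M z (\<alpha>\<^sub>M x))) (coactN y)"
    if bxy: "b \<in> carrier H" "x \<in> carrier M" "y \<in> carrier N" for b x y
  proof -
    let ?q = "P.action (\<alpha>i b) (\<alpha>\<^sub>P p)"
    have cl': "\<alpha>\<^sub>M x \<in> carrier M" "?q \<in> carrier P" "\<alpha>i b \<in> carrier H"
      "pure_tensor K N P y ?q \<in> carrier (tensor K N P)"
      by (intro linear_MNP bxy p)+
    have "\<phi> (pure_tensor K N (tensor K P M) y (pure_tensor K P M ?q x)) =
        tensor_assoc K P N M (pure_tensor K (tensor K P N) M (NP.B (pure_tensor K N P y ?q)) (\<alpha>\<^sub>M x))"
      unfolding \<phi>_def
      by (simp add: tensor_unassoc_pure tensor_map_pure[OF NP.mod_hom_braiding M.mod_hom_alphaM] mods bxy cl')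
    also have "\<dots> = tensor_lift K H N PNM (\<lambda>(c, z).
        pure_tensor K P (tensor K N M) (P.action (\<alpha>i (\<alpha>i c) \<star> \<alpha>i b) (\<alpha>\<^sub>P (\<alpha>\<^sub>P p)))
          (pure_tensor K N M z (\<alpha>\<^sub>M x))) (coactN y)"
    proof (rule NP.hom_braiding[where f = "\<lambda>s. tensor_assoc K P N M (pure_tensor K (tensor K P N) M s (\<alpha>\<^sub>M x))", OF _ bxy(3) cl'(2)])
      show "mod_hom K (tensor K P N) PNM (\<lambda>s. tensor_assoc K P N M (pure_tensor K (tensor K P N) M s (\<alpha>\<^sub>M x)))"
        by (intro linear_maps linear_MNP cl')
      fix c z assume cz: "c \<in> carrier H" "z \<in> carrier N"
      have c: "\<alpha>i c \<in> carrier H" "\<alpha>i (\<alpha>i c) \<in> carrier H" "P.action (\<alpha>i c) ?q \<in> carrier P"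
        by (intro linear_MNP cz cl')+
      \<comment> \<open>Reading \<open>\<alpha>i c\<close> as
        \<open>\<alpha> (\<alpha>i (\<alpha>i c))\<close> makes \<open>act_act\<close> applicable;
        this is the source of the double inverse.\<close>
      have "P.action (\<alpha>i c) ?q = P.action (\<alpha>i (\<alpha>i c) \<star> \<alpha>i b) (\<alpha>\<^sub>P (\<alpha>\<^sub>P p))"
        using P.act_act[OF c(2) cl'(3) cl(4)] c(1) by simp
      then show "tensor_assoc K P N M (pure_tensor K (tensor K P N) M (pure_tensor K P N (P.action (\<alpha>i c) ?q) z) (\<alpha>\<^sub>M x)) =
          pure_tensor K P (tensor K N M) (P.action (\<alpha>i (\<alpha>i c) \<star> \<alpha>i b) (\<alpha>\<^sub>P (\<alpha>\<^sub>P p))) (pure_tensor K N M z (\<alpha>\<^sub>M x))"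
        using tensor_assoc_pure[OF mods(4,3,2) c(3) cz(2) cl'(1)] by simp
    qed
    finally show ?thesis .
  qed
  let ?E = "\<lambda>h1 h2 x. tensor_lift K H N PNM (\<lambda>(c, z).
    pure_tensor K P (tensor K N M) (P.action (\<alpha>i (\<alpha>i c) \<star> \<alpha>i h2) (\<alpha>\<^sub>P (\<alpha>\<^sub>P p)))
      (pure_tensor K N M z (\<alpha>\<^sub>M x))) (coactN (N.action (\<alpha>i h1) (\<alpha>\<^sub>N n)))"
  have \<psi>_pure: "\<psi> (pure_tensor K (tensor K N M) P (pure_tensor K N M (N.action (\<alpha>i a) n) x) (\<alpha>\<^sub>P p)) =
      tensor_lift K H M PNM (\<lambda>(b, z). ?E (\<alpha> a) b z) (coactM x)"
    if ax: "a \<in> carrier H" "x \<in> carrier M" for a x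
  proof -
    \<comment> \<open>The inner inverse cancels, but keeping \<open>\<alpha>i (\<alpha> a)\<close>
      makes the result an instance of \<open>?E (\<alpha> a)\<close>, as Hom-coassociativity
      requires.\<close>
    let ?y = "N.action (\<alpha>i (\<alpha> a)) (\<alpha>\<^sub>N n)"
    have cl': "N.action (\<alpha>i a) n \<in> carrier N" "?y \<in> carrier N" "\<alpha>i a \<in> carrier H"
      "pure_tensor K M P x (\<alpha>\<^sub>P p) \<in> carrier (tensor K M P)"
      by (intro linear_MNP ax n p)+
    have "\<alpha>\<^sub>N (N.action (\<alpha>i a) n) = ?y"
      using ax n cl'(3) by (simp add: N.alpha_act)
    then have "\<psi> (pure_tensor K (tensor K N M) P (pure_tensor K N M (N.action (\<alpha>i a) n) x) (\<alpha>\<^sub>P p)) =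
        \<phi> (pure_tensor K N (tensor K P M) ?y (MP.B (pure_tensor K M P x (\<alpha>\<^sub>P p))))"
      unfolding \<psi>_def
      using tensor_assoc_pure[OF mods(3,2,4) cl'(1) ax(2) cl(4)]
        tensor_map_pure[OF N.mod_hom_alphaM MP.mod_hom_braiding cl'(1,4)] by simp
    also have "\<dots> = tensor_lift K H M PNM (\<lambda>(b, z). ?E (\<alpha> a) b z) (coactM x)"
    proof (rule MP.hom_braiding[where f = "\<lambda>s. \<phi> (pure_tensor K N (tensor K P M) ?y s)", OF _ ax(2) cl(4)])
      show "mod_hom K (tensor K P M) PNM (\<lambda>s. \<phi> (pure_tensor K N (tensor K P M) ?y s))"
        by (intro mod_hom_compose[OF \<phi>] linear_MNP cl')
    qed (intro \<phi>_pure cl'(2); assumption)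
    finally show ?thesis .
  qed
  have "yb_right (pure_tensor K M (tensor K N P) m (pure_tensor K N P n p)) =
      \<psi> (pure_tensor K (tensor K N M) P (MN.B (pure_tensor K M N m n)) (\<alpha>\<^sub>P p))"
    unfolding yb_right_def \<psi>_def \<phi>_def
    by (simp add: tensor_unassoc_pure tensor_map_pure[OF MN.mod_hom_braiding P.mod_hom_alphaM] mods m n p cl)
  also have "\<dots> = tensor_lift K H M PNM (\<lambda>(a, x).
      tensor_lift K H M PNM (\<lambda>(b, z). ?E (\<alpha> a) b z) (coactM x)) (coactM m)"
    by (rule MN.hom_braiding[where f = "\<lambda>s. \<psi> (pure_tensor K (tensor K N M) P s (\<alpha>\<^sub>P p))", OF _ m n \<psi>_pure])
       (intro mod_hom_compose[OF \<psi>] linear_MNP p)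
  also have "\<dots> = tensor_lift K H M PNM (\<lambda>(a, x). tensor_lift K H H PNM (\<lambda>(h1, h2). ?E h1 h2 (\<alpha>\<^sub>M x)) (\<Delta> a)) (coactM m)"
    by (rule M.comodule.tensor_lift_coact_coact[OF m]) (assumption | intro linear_MNP n p)+
  also have "\<dots> = yb_normal m n p"
  proof (rule tensor_lift_cong[OF _ cl(1)])
    show "bilinear_map K H M PNM (\<lambda>a x. tensor_lift K H H PNM (\<lambda>(h1, h2). ?E h1 h2 (\<alpha>\<^sub>M x)) (\<Delta> a))"
      by (intro linear_MNP n p)
    fix a x assume ax: "a \<in> carrier H" "x \<in> carrier M"
    define g where "g = \<alpha>i a"
    have g: "g \<in> carrier H" "\<Delta> g \<in> carrier (tensor K H H)"
      unfolding g_def by (intro linear_MNP ax)+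
    let ?F = "\<lambda>h z. pure_tensor K P (tensor K N M) (P.action h (\<alpha>\<^sub>P (\<alpha>\<^sub>P p))) (pure_tensor K N M z (\<alpha>\<^sub>M (\<alpha>\<^sub>M x)))"
    \<comment> \<open>Pulling \<open>?F\<close> back along the double inverse turns
      \<open>\<alpha>i (\<alpha>i c) \<star> g2\<close> into
      \<open>c \<star> \<alpha> (\<alpha> g2)\<close>, the product occurring in the Yetter-Drinfeld
      condition.\<close>
    let ?G = "\<lambda>h z. ?F (\<alpha>i (\<alpha>i h)) z"
    have G: "bilinear_map K H N PNM ?G"
      by (intro linear_MNP ax p)
    \<comment> \<open>Both components of \<open>\<Delta> a\<close> enter only through their images
      under \<open>\<alpha>i\<close>, so the sum can be taken over
      \<open>\<Delta> g\<close>.\<close>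
    have "tensor_lift K H H PNM (\<lambda>(h1, h2). ?E h1 h2 (\<alpha>\<^sub>M x)) (\<Delta> a) =
        tensor_lift K H H PNM (\<lambda>(g1, g2). tensor_lift K H N PNM (\<lambda>(c, z).
          ?F (\<alpha>i (\<alpha>i c) \<star> g2) z) (coactN (N.action g1 (\<alpha>\<^sub>N n)))) (\<Delta> g)"
      unfolding g_def by (rule tensor_lift_Delta_alpha_inv[OF _ ax(1)]) (intro linear_MNP ax n p)
    also have "\<dots> = tensor_lift K H H PNM (\<lambda>(g1, g2). tensor_lift K H N PNM (\<lambda>(c, z).
          ?G (c \<star> \<alpha> (\<alpha> g2)) z) (coactN (N.action g1 (\<alpha>\<^sub>N n)))) (\<Delta> g)"
    proof (intro tensor_lift_cong[OF _ g(2)] tensor_lift_cong)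
      fix g1 g2 c z assume *: "g1 \<in> carrier H" "g2 \<in> carrier H" "c \<in> carrier H" "z \<in> carrier N"
      have "\<alpha> g2 \<in> carrier H" "\<alpha> (\<alpha> g2) \<in> carrier H" "\<alpha>i c \<in> carrier H" by (intro linear_MNP *)+
      then show "?F (\<alpha>i (\<alpha>i c) \<star> g2) z = ?G (c \<star> \<alpha> (\<alpha> g2)) z"
        using * by (simp add: alpha_inv_mult)
    qed (assumption | intro linear_MNP ax n p)+
    also have "\<dots> = tensor_lift K H H PNM (\<lambda>(g1, g2). tensor_lift K H N PNM (\<lambda>(c, z).
          ?G (\<alpha> (\<alpha> g1) \<star> \<alpha> c) (N.action (\<alpha> g2) z)) (coactN (\<alpha>\<^sub>N n))) (\<Delta> g)"
      by (rule N.tensor_lift_yetter_drinfeld[OF g(1) cl(5) G])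
    also have "\<dots> = tensor_lift K H H PNM (\<lambda>(g1, g2). tensor_lift K H N PNM (\<lambda>(c, y).
          ?F (g1 \<star> c) (N.action (\<alpha> g2) (\<alpha>\<^sub>N y))) (coactN n)) (\<Delta> g)"
    proof (rule tensor_lift_cong[OF _ g(2)])
      show "bilinear_map K H H PNM (\<lambda>g1 g2. tensor_lift K H N PNM (\<lambda>(c, z).
          ?G (\<alpha> (\<alpha> g1) \<star> \<alpha> c) (N.action (\<alpha> g2) z)) (coactN (\<alpha>\<^sub>N n)))"
        by (intro linear_MNP ax n p)
      fix g1 g2 assume g12: "g1 \<in> carrier H" "g2 \<in> carrier H"
      have bil: "bilinear_map K H N PNM (\<lambda>c z. ?G (\<alpha> (\<alpha> g1) \<star> \<alpha> c) (N.action (\<alpha> g2) z))"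
        by (intro linear_MNP ax g12 p)
      \<comment> \<open>Colinearity at \<open>\<alpha>\<^sub>N n\<close> supplies a second
        \<open>\<alpha>\<close> on \<open>c\<close>. Both factors of the product then carry
        \<open>\<alpha>\<close> twice, and the double inverse in \<open>?G\<close> strips it off,
        leaving \<open>g1 \<star> c\<close>.\<close>
      have "tensor_lift K H N PNM (\<lambda>(c, z). ?G (\<alpha> (\<alpha> g1) \<star> \<alpha> c) (N.action (\<alpha> g2) z)) (coactN (\<alpha>\<^sub>N n)) =
          tensor_lift K H N PNM (\<lambda>(c, z). ?G (\<alpha> (\<alpha> g1) \<star> \<alpha> (\<alpha> c)) (N.action (\<alpha> g2) (\<alpha>\<^sub>N z))) (coactN n)"
        unfolding N.comodule.alpha_coact[OF n, symmetric]
        by (rule tensor_lift_tensor_map[OF mod_hom_alpha N.mod_hom_alphaM bil cl(2)])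
      also have "\<dots> = tensor_lift K H N PNM (\<lambda>(c, y). ?F (g1 \<star> c) (N.action (\<alpha> g2) (\<alpha>\<^sub>N y))) (coactN n)"
      proof (rule tensor_lift_cong[OF bilinear_map_comp_right[OF bil mod_hom_alpha N.mod_hom_alphaM] cl(2)])
        fix c y assume *: "c \<in> carrier H" "y \<in> carrier N"
        have "\<alpha> g1 \<in> carrier H" "\<alpha> c \<in> carrier H" "g1 \<star> c \<in> carrier H" "\<alpha> g1 \<star> \<alpha> c \<in> carrier H"
          by (intro linear_MNP * g12)+
        moreover have "\<alpha> (\<alpha> g1) \<star> \<alpha> (\<alpha> c) = \<alpha> (\<alpha> (g1 \<star> c))"
          using calculation * g12 by (simp add: alpha_mult)
        moreover have "\<alpha> (g1 \<star> c) \<in> carrier H" by (intro linear_MNP * g12)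
        ultimately show "?G (\<alpha> (\<alpha> g1) \<star> \<alpha> (\<alpha> c)) (N.action (\<alpha> g2) (\<alpha>\<^sub>N y)) =
            ?F (g1 \<star> c) (N.action (\<alpha> g2) (\<alpha>\<^sub>N y))"
          by (simp only: alpha_inv_alpha)
      qed
      finally show "tensor_lift K H N PNM (\<lambda>(c, z). ?G (\<alpha> (\<alpha> g1) \<star> \<alpha> c) (N.action (\<alpha> g2) z)) (coactN (\<alpha>\<^sub>N n)) =
          tensor_lift K H N PNM (\<lambda>(c, y). ?F (g1 \<star> c) (N.action (\<alpha> g2) (\<alpha>\<^sub>N y))) (coactN n)" .
    qed
    finally show "tensor_lift K H H PNM (\<lambda>(h1, h2). ?E h1 h2 (\<alpha>\<^sub>M x)) (\<Delta> a) =
        tensor_lift K H H PNM (\<lambda>(g1, g2). tensor_lift K H N PNM (\<lambda>(c, y).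
          ?F (g1 \<star> c) (N.action (\<alpha> g2) (\<alpha>\<^sub>N y))) (coactN n)) (\<Delta> (\<alpha>i a))"
      unfolding g_def .
  qed
  finally show ?thesis .
qed

text \<open>Uniqueness on pure tensors is applied twice: first to the outer tensor product, then,
  with \<open>m\<close> fixed, to the linear dependence on the second factor.\<close>

lemma tensor3_hom_eq:
  assumes f: "mod_hom K (tensor K M (tensor K N P)) T f" and g: "mod_hom K (tensor K M (tensor K N P)) T g"
    and eq: "\<And>m n p. m \<in> carrier M \<Longrightarrow> n \<in> carrier N \<Longrightarrow> p \<in> carrier P \<Longrightarrow>
      f (pure_tensor K M (tensor K N P) m (pure_tensor K N P n p)) =
      g (pure_tensor K M (tensor K N P) m (pure_tensor K N P n p))"
    and t: "t \<in> carrier (tensor K M (tensor K N P))"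
  shows "f t = g t"
proof (rule tensor_hom_eq[OF f g _ _ _ t])
  fix m s assume m: "m \<in> carrier M" and s: "s \<in> carrier (tensor K N P)"
  have l: "mod_hom K (tensor K N P) (tensor K M (tensor K N P)) (\<lambda>s. pure_tensor K M (tensor K N P) m s)"
    by (intro linear_MNP m)
  show "f (pure_tensor K M (tensor K N P) m s) = g (pure_tensor K M (tensor K N P) m s)"
    by (rule tensor_hom_eq[OF mod_hom_compose[OF f l] mod_hom_compose[OF g l] mods(3,4) eq[OF m] s])
qed (intro mods module_tensor)+

lemma hom_yang_baxter: "t \<in> carrier (tensor K M (tensor K N P)) \<Longrightarrow> yb_left t = yb_right t"
  by (rule tensor3_hom_eq[OF mod_hom_yb]) (simp_all add: yb_left_pure yb_right_pure)

end

theorem proposition2p4: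
  fixes K :: "('k, 'r) ring_scheme"
    and H :: "('k, 'h) module"
    and M :: "('k, 'm) module" and N :: "('k, 'n) module" and P :: "('k, 'p) module"
  assumes "hom_bialgebra K H \<mu> \<Delta> \<alpha>"
    and "bij_betw \<alpha> (carrier H) (carrier H)"
    and "yetter_drinfeld_module K H \<mu> \<Delta> \<alpha> M \<alpha>\<^sub>M actM coactM"
    and "yetter_drinfeld_module K H \<mu> \<Delta> \<alpha> N \<alpha>\<^sub>N actN coactN"
    and "yetter_drinfeld_module K H \<mu> \<Delta> \<alpha> P \<alpha>\<^sub>P actP coactP"
  defines "B\<^sub>M\<^sub>N \<equiv> yd_braiding K H \<alpha> M coactM N actN"
    and "B\<^sub>M\<^sub>P \<equiv> yd_braiding K H \<alpha> M coactM P actP"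
    and "B\<^sub>N\<^sub>P \<equiv> yd_braiding K H \<alpha> N coactN P actP"
  shows "(\<forall>t\<in>carrier (tensor K M N).
           (tensor_map K N M N M \<alpha>\<^sub>N \<alpha>\<^sub>M \<circ> B\<^sub>M\<^sub>N) t =
           (B\<^sub>M\<^sub>N \<circ> tensor_map K M N M N \<alpha>\<^sub>M \<alpha>\<^sub>N) t) \<and>
         (\<forall>t\<in>carrier (tensor K M (tensor K N P)).
           (tensor_map K P (tensor K M N) P (tensor K N M) \<alpha>\<^sub>P B\<^sub>M\<^sub>N
             \<circ> tensor_assoc K P M N
             \<circ> tensor_map K (tensor K M P) N (tensor K P M) N B\<^sub>M\<^sub>P \<alpha>\<^sub>N
             \<circ> tensor_unassoc K M P N
             \<circ> tensor_map K M (tensor K N P) M (tensor K P N) \<alpha>\<^sub>M B\<^sub>N\<^sub>P) t =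
           (tensor_assoc K P N M
             \<circ> tensor_map K (tensor K N P) M (tensor K P N) M B\<^sub>N\<^sub>P \<alpha>\<^sub>M
             \<circ> tensor_unassoc K N P M
             \<circ> tensor_map K N (tensor K M P) N (tensor K P M) \<alpha>\<^sub>N B\<^sub>M\<^sub>P
             \<circ> tensor_assoc K N M P
             \<circ> tensor_map K (tensor K M N) P (tensor K N M) P B\<^sub>M\<^sub>N \<alpha>\<^sub>P
             \<circ> tensor_unassoc K M N P) t)"
proof -
  interpret yetter_drinfeld_triple K H \<mu> \<Delta> \<alpha> M \<alpha>\<^sub>M actM coactM N \<alpha>\<^sub>N actN coactN P \<alpha>\<^sub>P actP coactP
    by (intro yetter_drinfeld_triple.intro bijective_hom_bialgebra.intro
        bijective_hom_bialgebra_axioms.intro assms)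
  show ?thesis
    unfolding B\<^sub>M\<^sub>N_def B\<^sub>M\<^sub>P_def B\<^sub>N\<^sub>P_def
    using MN.braiding_alpha hom_yang_baxter by (simp add: yb_left_def yb_right_def)
qed

end
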